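(* Let $K$ be a field of characteristic $2$ and let $F|K=K(z,y)|K$ be a function field of type (a), (b) or (c) as defined in the context. Then the group $\mathrm{Aut}(F|K)$ of automorphisms of $F|K$ is trivial. If $F|K$ is of type (a) or (c), then (a) $\iota=bc^3$ (in type (a)), (c) $\iota=ab^2d^2$ (in type (c)), is an invariant of the function field $F|K$, i.e. two $K$-isomorphic function fields of the same type have the same value of $\iota$.
   Context: $K^2$ denotes the set of squares of $K$. A function field $F|K=K(z,y)|K$ is of one of the following types if $z$ is transcendental over $K$ and the generators satisfy the irreducible equation: Type (a): $b y^4 + d z^4 + y^2 z^2 + z^3 + (b + b^2 c^3) z^2 + a y^2 + a z + a b^2 c^3 + a^2 d = 0$, with $a,b,c,d\in K$, $a\notin K^2$, $b,c\neq0$. Type (b): $y^4 + a z^4 + z^3 + b z + c = 0$, with $a,b,c\in K$, $b\notin K^2$. Type (c): $y^4 + d z^2 y^2 + (c+a) z^4 + d z^3 + bd\, y^2 + z^2 + bd\, z + b^2 c = 0$, with $a,b,c,d\in K$, $a,b\notin K^2$, $d\neq0$. $\mathrm{Aut}(F|K)$ is the group of field automorphisms of $F$ fixing $K$ elementwise. *)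

theory Defs
  imports
    "HOL-Algebra.Elementary_Groups"
    "HOL-Computational_Algebra.Computational_Algebra"
begin

text \<open>
  A field extension \<open>F|K\<close> is a field homomorphism \<open>h\<close> (necessarily injective) from the
  type \<open>'k\<close> of \<open>K\<close> to the type \<open>'f\<close> of \<open>F\<close>.
\<close>

definition field_extension :: "('k::field \<Rightarrow> 'f::field) \<Rightarrow> bool" where
  "field_extension h \<longleftrightarrow>
     h 1 = 1 \<and> (\<forall>x y. h (x + y) = h x + h y) \<and> (\<forall>x y. h (x * y) = h x * h y)"

definition is_subfield :: "'f::field set \<Rightarrow> bool" where
  "is_subfield L \<longleftrightarrow>
     0 \<in> L \<and> 1 \<in> L \<and> (\<forall>x\<in>L. \<forall>y\<in>L. x + y \<in> L \<and> x * y \<in> L) \<and>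
     (\<forall>x\<in>L. - x \<in> L \<and> inverse x \<in> L)"

text \<open>The subfield \<open>K(S)\<close> of \<open>F\<close>.\<close>

definition adjoin :: "('k::field \<Rightarrow> 'f::field) \<Rightarrow> 'f set \<Rightarrow> 'f set" where
  "adjoin h S = \<Inter> {L. is_subfield L \<and> range h \<subseteq> L \<and> S \<subseteq> L}"

definition transcendental_over :: "('k::field \<Rightarrow> 'f::field) \<Rightarrow> 'f \<Rightarrow> bool" where
  "transcendental_over h z \<longleftrightarrow> (\<forall>p::'k poly. p \<noteq> 0 \<longrightarrow> poly (map_poly h p) z \<noteq> 0)"

definition K_isomorphism ::
    "('k::field \<Rightarrow> 'f::field) \<Rightarrow> ('k \<Rightarrow> 'g::field) \<Rightarrow> ('f \<Rightarrow> 'g) \<Rightarrow> bool" where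
  "K_isomorphism h h' \<sigma> \<longleftrightarrow> field_extension \<sigma> \<and> bij \<sigma> \<and> (\<forall>x. \<sigma> (h x) = h' x)"

definition K_isomorphic ::
    "('k::field \<Rightarrow> 'f::field) \<Rightarrow> ('k \<Rightarrow> 'g::field) \<Rightarrow> bool" where
  "K_isomorphic h h' \<longleftrightarrow> (\<exists>\<sigma>. K_isomorphism h h' \<sigma>)"

definition Aut :: "('k::field \<Rightarrow> 'f::field) \<Rightarrow> ('f \<Rightarrow> 'f) monoid" where
  "Aut h = \<lparr>carrier = {\<sigma>. K_isomorphism h h \<sigma>}, monoid.mult = (\<circ>), one = id\<rparr>"

text \<open>
  The quartics are polymorphic: evaluated in \<open>F\<close> they give the relation between the
  generators \<open>z, y\<close>; evaluated in \<open>K[Z][Y]\<close>, at constants and the two indeterminates, they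
  give the polynomial whose irreducibility is required.
\<close>

definition quartic_a :: "'r \<Rightarrow> 'r \<Rightarrow> 'r \<Rightarrow> 'r \<Rightarrow> 'r \<Rightarrow> 'r \<Rightarrow> 'r::comm_ring_1" where
  "quartic_a a b c d z y =
     b * y^4 + d * z^4 + y^2 * z^2 + z^3 + (b + b^2 * c^3) * z^2 + a * y^2 + a * z
       + a * b^2 * c^3 + a^2 * d"

definition quartic_b :: "'r \<Rightarrow> 'r \<Rightarrow> 'r \<Rightarrow> 'r \<Rightarrow> 'r \<Rightarrow> 'r::comm_ring_1" where
  "quartic_b a b c z y = y^4 + a * z^4 + z^3 + b * z + c"

definition quartic_c :: "'r \<Rightarrow> 'r \<Rightarrow> 'r \<Rightarrow> 'r \<Rightarrow> 'r \<Rightarrow> 'r \<Rightarrow> 'r::comm_ring_1" where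
  "quartic_c a b c d z y =
     y^4 + d * z^2 * y^2 + (c + a) * z^4 + d * z^3 + b * d * y^2 + z^2 + b * d * z + b^2 * c"

abbreviation Const :: "'k::field \<Rightarrow> 'k poly poly" where
  "Const x \<equiv> [:[:x:]:]"

abbreviation Z_indet :: "'k::field poly poly" where
  "Z_indet \<equiv> [:[:0, 1:]:]"

abbreviation Y_indet :: "'k::field poly poly" where
  "Y_indet \<equiv> [:0, 1:]"

abbreviation squares :: "'k::field set" where
  "squares \<equiv> range (\<lambda>x. x^2)"

text \<open>
  In each type the relation makes \<open>y\<close> algebraic over \<open>K(z)\<close>, so \<open>F|K\<close> is
  automatically finitely generated of transcendence degree one.
\<close>

definition type_a :: "('k::field \<Rightarrow> 'f::field) \<Rightarrow> 'k \<Rightarrow> 'k \<Rightarrow> 'k \<Rightarrow> 'k \<Rightarrow> bool" where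
  "type_a h a b c d \<longleftrightarrow>
     a \<notin> squares \<and> b \<noteq> 0 \<and> c \<noteq> 0 \<and>
     irreducible (quartic_a (Const a) (Const b) (Const c) (Const d) Z_indet Y_indet) \<and>
     (\<exists>z y. adjoin h {z, y} = UNIV \<and> transcendental_over h z \<and>
            quartic_a (h a) (h b) (h c) (h d) z y = 0)"

definition type_b :: "('k::field \<Rightarrow> 'f::field) \<Rightarrow> 'k \<Rightarrow> 'k \<Rightarrow> 'k \<Rightarrow> bool" where
  "type_b h a b c \<longleftrightarrow>
     b \<notin> squares \<and>
     irreducible (quartic_b (Const a) (Const b) (Const c) Z_indet Y_indet) \<and>
     (\<exists>z y. adjoin h {z, y} = UNIV \<and> transcendental_over h z \<and>
            quartic_b (h a) (h b) (h c) z y = 0)"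

definition type_c :: "('k::field \<Rightarrow> 'f::field) \<Rightarrow> 'k \<Rightarrow> 'k \<Rightarrow> 'k \<Rightarrow> 'k \<Rightarrow> bool" where
  "type_c h a b c d \<longleftrightarrow>
     a \<notin> squares \<and> b \<notin> squares \<and> d \<noteq> 0 \<and>
     irreducible (quartic_c (Const a) (Const b) (Const c) (Const d) Z_indet Y_indet) \<and>
     (\<exists>z y. adjoin h {z, y} = UNIV \<and> transcendental_over h z \<and>
            quartic_c (h a) (h b) (h c) (h d) z y = 0)"

definition iota_a :: "'k::field \<Rightarrow> 'k \<Rightarrow> 'k" where
  "iota_a b c = b * c^3"

definition iota_c :: "'k::field \<Rightarrow> 'k \<Rightarrow> 'k \<Rightarrow> 'k" where
  "iota_c a b d = a * b^2 * d^2"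

end

theory Submission
  imports Defs
begin

text \<open>
  In characteristic two the subfields \<open>K(F^2)\<close>, \<open>K(F^4)\<close>, \<open>K(F^8)\<close> of \<open>F\<close> are intrinsic: a
  \<open>K\<close>-isomorphism carries each of them to the corresponding one. For the function fields
  of type (a) and (b) the field \<open>K(F^4)\<close>, and for those of type (c) the field \<open>K(F^8)\<close>, is
  a rational function field \<open>K(t)\<close>, and \<open>F\<close> arises from it by extracting square roots:

  \<^item> type (a): \<open>u = b^2 c^3 / (b t^2 + t + d)\<close>, \<open>z^2 = a + u\<close>, \<open>y^2 = z + t u\<close>,
    with \<open>t = (y^2 + z) / (z^2 + a)\<close>;
  \<^item> type (b): \<open>t = z\<close> and \<open>y^4 = a t^4 + t^3 + b t + c\<close>;
  \<^item> type (c): \<open>u^2 = a b^2 / (t^2 + d t + c + a)\<close>, \<open>z^2 = u + b\<close>, \<open>y^2 = z + t u\<close>,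
    with \<open>t = (y^2 + z) / (z^2 + b)\<close>.

  In types (a) and (c) the quartic, written in \<open>s = y^2 + z\<close> and \<open>u\<close>, is a conic; it is the
  equation for \<open>u\<close> above, with \<open>t = s / u\<close>. Square roots are unique in characteristic two, so \<open>t\<close> and the
  coefficients determine \<open>z\<close> and \<open>y\<close>.

  Transporting generators along an isomorphism reduces everything to two pairs of
  generators \<open>(z, y)\<close>, \<open>(z', y')\<close> of one field \<open>F\<close>, with coefficients \<open>a, b, \<dots>\<close> and
  \<open>a', b', \<dots>\<close>. Then \<open>K(t) = K(t')\<close>, so \<open>t'\<close> is a fractional linear function of \<open>t\<close>
  (\<open>generators_of_rational_function_field\<close>). What has to be shown is that it is affine, that
  the invariants agree, and that \<open>t' = t\<close> as soon as the coefficients agree.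

  Each of \<open>z'\<close>, \<open>y'\<close> (and \<open>u'\<close> in type (c)) is a linear polynomial in \<open>z\<close>, \<open>y\<close>, \<open>u\<close> over
  the next lower step of the tower. Squaring and comparing coefficients gives relations
  \<open>X = R\<^sub>0^2 + R\<^sub>1^2 Y\<close> with given polynomials \<open>X, Y\<close> in \<open>t\<close> and rational functions \<open>R\<^sub>0, R\<^sub>1\<close>.
  Here \<open>Y\<close> has a nonzero constant derivative in types (a) and (c), so differentiation,
  which kills squares, forces \<open>R\<^sub>0\<close> and \<open>R\<^sub>1\<close> to be polynomials
  (\<open>polynomial_from_square_sum\<close>). From then on only coefficients of polynomials are compared
  (\<open>type_a_core\<close>, \<open>type_b_core\<close>, \<open>type_c_core\<close>), with two tools: the derivative of
  \<open>X = R\<^sub>0^2 + R\<^sub>1^2 Y\<close> determines \<open>R\<^sub>1\<close>, and a coefficient identity \<open>a r^2 = s^2\<close> forces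
  \<open>r = 0\<close> because \<open>a\<close> is not a square. The invariance of \<open>\<iota>\<close> comes from the
  coordinate of \<open>z'\<close> along \<open>z\<close> in type (a) and of \<open>u'\<close> along \<open>u\<close> in type (c). It equals \<open>e N / N'\<close>,
  where \<open>N\<close> and \<open>N'\<close> are the denominators above for the two pairs of generators and \<open>e\<close> is a
  constant with \<open>e^2 \<iota> = \<iota>'\<close>; the coordinates of \<open>y'\<close> yield \<open>e = 1\<close>.
\<close>


section \<open>Squares in characteristic two\<close>

lemma char_two_eq_zero: "CHAR('a::comm_ring_1) = 2 \<Longrightarrow> (2::'a) = 0"
  by (metis of_nat_CHAR of_nat_numeral)

lemma square_add_char_two:
  fixes x y :: "'a::comm_ring_1"
  assumes "CHAR('a) = 2"
  shows "(x + y)^2 = x^2 + y^2"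
  using char_two_eq_zero[OF assms] by (simp add: power2_sum)

lemma square_eq_iff_char_two:
  fixes x y :: "'a::idom"
  assumes "CHAR('a) = 2"
  shows "x^2 = y^2 \<longleftrightarrow> x = y"
  using power2_eq_iff[of x y] uminus_CHAR_2[OF assms, of y] by auto

lemma square_pCons_char_two:
  fixes p :: "'a::comm_ring_1 poly"
  assumes "CHAR('a) = 2"
  shows "(pCons a p)^2 = pCons (a^2) (pCons 0 (p^2))"
proof -
  have "pCons a p = [:a:] + pCons 0 p" by simp
  moreover have "CHAR('a poly) = 2" using assms by simp
  ultimately show ?thesis
    by (simp only: square_add_char_two) (simp add: power2_eq_square)
qed

lemma pderiv_square_char_two:
  fixes p :: "'a::idom poly"
  assumes "CHAR('a) = 2"
  shows "pderiv (p^2) = 0"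
proof -
  have "p * pderiv p + p * pderiv p = 2 * (p * pderiv p)" by simp
  also have "\<dots> = 0" using char_two_eq_zero[where 'a="'a poly"] assms by simp
  finally show ?thesis by (simp add: power2_eq_square pderiv_mult)
qed

text \<open>
  Polynomial rings over a field are integrally closed; here a square root of \<open>P\<close> is found by long
  division. The leading coefficient of \<open>P\<close> is a square and its degree is even, and in
  characteristic two removing the square of a monomial \<open>c t^n\<close> from \<open>P\<close> preserves the
  hypothesis, with \<open>r\<close> replaced by \<open>r - c t^n q\<close>.
\<close>

lemma square_quotient_imp_square:
  fixes P q r :: "'a::field poly"
  assumes char: "CHAR('a) = 2" and eq: "P * q^2 = r^2" and "q \<noteq> 0"
  shows "\<exists>k. P = k^2 \<and> r = k * q"
  using eq
proof (induction "degree P" arbitrary: P r rule: less_induct)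
  case less
  show ?case
  proof (cases "P = 0")
    case True
    with less.prems show ?thesis by (intro exI[of _ 0]) auto
  next
    case False
    have "degree P + 2 * degree q = 2 * degree r"
      using arg_cong[OF less.prems, of degree] False \<open>q \<noteq> 0\<close>
      by (cases "r = 0") (simp_all add: degree_mult_eq degree_power_eq)
    then obtain n where n: "degree P = 2 * n" "degree r = n + degree q"
      by (intro that[of "degree r - degree q"]) auto
    define c where "c = lead_coeff r / lead_coeff q"
    have "lead_coeff P * (lead_coeff q)^2 = (lead_coeff r)^2"
      using arg_cong[OF less.prems, of lead_coeff] by (simp add: lead_coeff_mult lead_coeff_power)
    then have c: "lead_coeff P = c^2"
      using \<open>q \<noteq> 0\<close> by (simp add: c_def field_simps power_divide)
    define P' where "P' = P - (monom c n)^2"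
    define r' where "r' = r - monom c n * q"
    note [simp] = minus_CHAR_2 
    have eq': "P' * q^2 = r'^2"
      using less.prems char by (simp add: P'_def r'_def square_add_char_two algebra_simps power_mult_distrib)
    have lead: "coeff P' (2 * n) = 0"
      using c n by (simp add: P'_def monom_power mult.commute)
    have deg: "degree P' \<le> 2 * n"
      unfolding P'_def using n by (intro degree_diff_le) (auto simp: monom_power degree_monom_le mult.commute)
    have "\<exists>k. P' = k^2 \<and> r' = k * q"
    proof (cases "P' = 0")
      case True
      with eq' show ?thesis by (intro exI[of _ 0]) auto
    next
      case False
      with lead deg have "degree P' < degree P"
        using n by (metis leading_coeff_0_iff le_neq_implies_less)
      then show ?thesis using less.hyps eq' by blast
    qed
    then obtain k where "P' = k^2" "r' = k * q" by blast
    moreover have "P = P' + (monom c n)^2" "r = r' + monom c n * q"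
      by (simp_all only: P'_def r'_def diff_add_cancel)
    ultimately have "P = (k + monom c n)^2 \<and> r = (k + monom c n) * q"
      using char by (simp only: square_add_char_two semiring_char_poly distrib_right)
    then show ?thesis by blast
  qed
qed

lemma add_self_char_two:
  fixes x :: "'a::comm_ring_1"
  assumes "CHAR('a) = 2"
  shows "x + x = 0"
  using char_two_eq_zero[OF assms] by (metis mult_2 mult_zero_left)

lemma sum_eqD_char_two:
  fixes x y z :: "'a::comm_ring_1"
  assumes "CHAR('a) = 2" and "x = y + z"
  shows "y = x + z"
  using add_self_char_two[OF assms(1), of z] by (simp add: assms(2) add.assoc)

lemma sum_eq_zeroD_char_two:
  fixes x y :: "'a::comm_ring_1"
  assumes "CHAR('a) = 2" and "x + y = 0"
  shows "x = y"
  using sum_eqD_char_two[OF assms(1) assms(2)[symmetric]] by simp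

text \<open>
  The square of \<open>\<Sum> k\<^sub>i t^i\<close> is \<open>\<Sum> k\<^sub>i^2 t^(2i)\<close>. Degree six is the largest one that occurs
  below, and the smaller degrees are covered by zero coefficients.
\<close>

lemma square_eq_coeffs:
  fixes k :: "'a::idom poly"
  assumes char: "CHAR('a) = 2" and eq: "k^2 = [:x0, x1, x2, x3, x4, x5, x6:]"
  shows "\<exists>p q r s. k = [:p, q, r, s:] \<and> x0 = p^2 \<and> x1 = 0 \<and> x2 = q^2 \<and> x3 = 0 \<and>
           x4 = r^2 \<and> x5 = 0 \<and> x6 = s^2"
proof -
  have "degree (k^2) \<le> 6"
    unfolding eq by (intro degree_le) (auto simp: coeff_pCons split: nat.splits)
  hence "degree k \<le> 3" by (cases "k = 0") (auto simp: degree_power_eq)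
  hence "k = [:coeff k 0, coeff k 1, coeff k 2, coeff k 3:]"
    by (intro poly_eqI) (auto simp: coeff_pCons numeral_2_eq_2 numeral_3_eq_3 intro!: coeff_eq_0 split: nat.splits)
  then obtain p q r s where k: "k = [:p, q, r, s:]" by blast
  have "[:x0, x1, x2, x3, x4, x5, x6:] = [:p^2, 0, q^2, 0, r^2, 0, s^2:]"
    unfolding eq[symmetric] by (simp add: k square_pCons_char_two[OF char])
  hence "x0 = p^2 \<and> x1 = 0 \<and> x2 = q^2 \<and> x3 = 0 \<and> x4 = r^2 \<and> x5 = 0 \<and> x6 = s^2"
    by (simp only: pCons_eq_iff)
  with k show ?thesis by blast
qed

lemma smult_square_eq_coeffs:
  fixes k :: "'a::field poly"
  assumes char: "CHAR('a) = 2" and eq: "smult e (k^2) = [:x0, x1, x2, x3, x4:]" and e: "e \<noteq> 0"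
  shows "\<exists>p q r. k = [:p, q, r:] \<and> x0 = e * p^2 \<and> x1 = 0 \<and> x2 = e * q^2 \<and> x3 = 0 \<and> x4 = e * r^2"
proof -
  have "k^2 = smult (inverse e) (smult e (k^2))" using e by simp
  hence "k^2 = [:x0 / e, x1 / e, x2 / e, x3 / e, x4 / e, 0, 0:]"
    unfolding eq by (simp add: field_simps)
  from square_eq_coeffs[OF char this] obtain p q r s where *:
    "k = [:p, q, r, s:]" "x0/e = p^2" "x1/e = 0" "x2/e = q^2" "x3/e = 0" "x4/e = r^2" "0 = s^2"
    by blast
  moreover from * e have "x0 = e * p^2" "x1 = 0" "x2 = e * q^2" "x3 = 0" "x4 = e * r^2" "s = 0"
    by (simp_all add: divide_eq_eq)
  ultimately show ?thesis by (intro exI[of _ p] exI[of _ q] exI[of _ r]) simp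
qed

lemma smult_square_eq_linear:
  fixes k :: "'a::field poly"
  assumes char: "CHAR('a) = 2" and eq: "smult e (k^2) = [:x0, x1, x2:]" and e: "e \<noteq> 0"
  shows "\<exists>p q. k = [:p, q:] \<and> x0 = e * p^2 \<and> x1 = 0 \<and> x2 = e * q^2"
proof -
  have "smult e (k^2) = [:x0, x1, x2, 0, 0:]" using eq by simp
  from smult_square_eq_coeffs[OF char this e] obtain p q r where
    *: "k = [:p, q, r:]" "x0 = e * p^2" "x1 = 0" "x2 = e * q^2" "0 = e * r^2" by blast
  with e have "r = 0" by simp
  with * show ?thesis by auto
qed

lemma smult_square_eq_const:
  fixes k :: "'a::field poly"
  assumes char: "CHAR('a) = 2" and eq: "smult e (k^2) = [:x0:]" and e: "e \<noteq> 0"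
  shows "\<exists>p. k = [:p:] \<and> x0 = e * p^2"
proof -
  have "smult e (k^2) = [:x0, 0, 0:]" using eq by simp
  from smult_square_eq_linear[OF char this e] obtain p q where
    *: "k = [:p, q:]" "x0 = e * p^2" "0 = e * q^2" by blast
  with e have "q = 0" by simp
  with * show ?thesis by auto
qed

text \<open>
  This is how the hypotheses on nonsquare coefficients enter all the comparisons below.
\<close>

lemma nonsquare_mult_square:
  fixes a x y :: "'a::field"
  assumes "a \<notin> squares" and "a * y^2 = x^2"
  shows "y = 0" and "x = 0"
proof -
  have "a = (x / y)^2" if "y \<noteq> 0" using assms(2) that by (simp add: field_simps)
  thus "y = 0" using assms(1) by blast
  thus "x = 0" using assms(2) by simp
qed

section \<open>Fractions of polynomials\<close>

lemma bezout_reduced_fraction: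
  fixes p q :: "'a::field poly"
  shows "\<exists>g p1 q1 a b. p = g * p1 \<and> q = g * q1 \<and> a * p1 + b * q1 = 1"
proof (induction "if q = 0 then 0 else Suc (degree q)" arbitrary: p q rule: less_induct)
  case less
  show ?case
  proof (cases "q = 0")
    case True
    thus ?thesis by (intro exI[of _ p] exI[of _ 1] exI[of _ 0]) auto
  next
    case False
    have "p mod q = 0 \<or> degree (p mod q) < degree q"
      using degree_mod_less[OF False] by blast
    hence "(if p mod q = 0 then 0 else Suc (degree (p mod q))) < (if q = 0 then 0 else Suc (degree q))"
      using False by auto
    from less.hyps[OF this] obtain g q1 r1 a b where
      *: "q = g * q1" "p mod q = g * r1" "a * q1 + b * r1 = 1" by blast
    have "p = g * ((p div q) * q1 + r1)"
      using div_mult_mod_eq[of p q] * by (simp add: algebra_simps)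
    moreover have "b * ((p div q) * q1 + r1) + (a - b * (p div q)) * q1 = 1"
      using *(3) by (simp add: algebra_simps)
    ultimately show ?thesis using *(1) by blast
  qed
qed

lemma dvd_coprime_power:
  fixes p q R :: "'a::field poly"
  assumes "a * p + b * q = 1" and "q dvd R * p ^ n"
  shows "q dvd R"
  using assms(2)
proof (induction n)
  case (Suc n)
  have "R * p ^ n = a * (R * p ^ Suc n) + q * (b * R * p ^ n)"
  proof -
    have "R * p ^ n = (a * p + b * q) * (R * p ^ n)" by (simp only: assms(1) mult_1)
    thus ?thesis by (simp add: algebra_simps)
  qed
  hence "q dvd R * p ^ n" using Suc.prems by (metis dvd_add dvd_mult dvd_triv_left)
  thus ?case by (rule Suc.IH)
qed simp

text \<open>
  All terms of the relation but the last nonzero one contain a power of \<open>q\<close> that is higher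
  than that of the last one; cancelling the common power leaves a relation in which \<open>q\<close>
  divides every other term.
\<close>

lemma dvd_coefficient_of_homogeneous_relation:
  fixes p q :: "'a::field poly" and R :: "nat \<Rightarrow> 'a poly"
  assumes "a * p + b * q = 1" and "q \<noteq> 0"
    and "(\<Sum>i\<le>n. R i * p ^ i * q ^ (n - i)) = 0" and "\<exists>i\<le>n. R i \<noteq> 0"
  shows "\<exists>i\<le>n. R i \<noteq> 0 \<and> q dvd R i"
  using assms(3,4)
proof (induction n)
  case 0
  thus ?case by auto
next
  case (Suc n)
  have "(\<Sum>i\<le>n. R i * p ^ i * q ^ (Suc n - i)) = q * (\<Sum>i\<le>n. R i * p ^ i * q ^ (n - i))"
    by (simp add: sum_distrib_left Suc_diff_le mult_ac)
  with Suc.prems(1) have eq: "q * (\<Sum>i\<le>n. R i * p ^ i * q ^ (n - i)) + R (Suc n) * p ^ Suc n = 0"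
    by simp
  show ?case
  proof (cases "R (Suc n) = 0")
    case True
    with eq \<open>q \<noteq> 0\<close> have "(\<Sum>i\<le>n. R i * p ^ i * q ^ (n - i)) = 0" by simp
    moreover from True Suc.prems(2) have "\<exists>i\<le>n. R i \<noteq> 0" by (auto simp: le_Suc_eq)
    ultimately show ?thesis using Suc.IH by (meson le_SucI)
  next
    case False
    have "q dvd R (Suc n) * p ^ Suc n"
      using dvd_add_right_iff[OF dvd_triv_left, of q _ "R (Suc n) * p ^ Suc n"] eq
      by (metis dvd_0_right)
    hence "q dvd R (Suc n)" by (rule dvd_coprime_power[OF assms(1)])
    with False show ?thesis by blast
  qed
qed

section \<open>The inseparable tower of an extension\<close>

definition subfield_over :: "('k::field \<Rightarrow> 'f::field) \<Rightarrow> 'f set \<Rightarrow> bool" where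
  "subfield_over h L \<longleftrightarrow> is_subfield L \<and> range h \<subseteq> L"

text \<open>
  This is the field \<open>E(x)\<close> when \<open>E\<close> is a field that contains \<open>x^2\<close>.
\<close>

definition quadratic_adjoin :: "'f::field set \<Rightarrow> 'f \<Rightarrow> 'f set" where
  "quadratic_adjoin E x = {A + B * x |A B. A \<in> E \<and> B \<in> E}"

locale char_two_extension =
  fixes h :: "'k::field \<Rightarrow> 'f::field"
  assumes ext: "field_extension h" and char: "CHAR('k) = 2"
begin

lemma h_1 [simp]: "h 1 = 1" and h_add: "h (x + y) = h x + h y" and h_mult: "h (x * y) = h x * h y"
  using ext by (auto simp: field_extension_def)

lemma h_0 [simp]: "h 0 = 0"
  using h_add[of 0 0] by (metis add_0 add_cancel_right_right)

lemma h_power: "h (x ^ n) = h x ^ n"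
  by (induction n) (simp_all add: h_mult)

lemma h_eq_0_iff [simp]: "h x = 0 \<longleftrightarrow> x = 0"
proof
  assume "h x = 0"
  show "x = 0"
  proof (rule ccontr)
    assume "x \<noteq> 0"
    hence "h x * h (inverse x) = 1" unfolding h_mult[symmetric] by simp
    thus False using \<open>h x = 0\<close> by simp
  qed
qed simp

lemma h_minus: "h (- x) = - h x"
  using h_add[of x "- x"] by (simp add: eq_neg_iff_add_eq_0 add.commute)

lemma h_inverse: "h (inverse x) = inverse (h x)"
proof (cases "x = 0")
  case False
  hence "h x * h (inverse x) = 1" unfolding h_mult[symmetric] by simp
  thus ?thesis by (simp add: inverse_unique)
qed simp

lemma char_top: "CHAR('f) = 2"
proof -
  have "h 2 = h 1 + h 1" unfolding h_add[symmetric] by simp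
  hence "(2::'f) = 0" using char_two_eq_zero[OF char] by simp
  hence "of_nat 2 = (0::'f)" by simp
  hence "CHAR('f) dvd 2" unfolding of_nat_eq_0_iff_char_dvd .
  moreover have "CHAR('f) \<noteq> 1" by simp
  ultimately show ?thesis using prime_nat_iff two_is_prime_nat by blast
qed

lemmas square_add = square_add_char_two[OF char_top]

definition ev :: "'f \<Rightarrow> 'k poly \<Rightarrow> 'f" where
  "ev t p = poly (map_poly h p) t"

lemma ev_0 [simp]: "ev t 0 = 0"
  by (simp add: ev_def)

lemma ev_pCons [simp]: "ev t (pCons a p) = h a + t * ev t p"
  by (simp add: ev_def map_poly_pCons)

lemma ev_1 [simp]: "ev t 1 = 1"
  unfolding one_pCons by simp

lemma ev_add [simp]: "ev t (p + q) = ev t p + ev t q"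
  by (induction p q rule: poly_induct2) (simp_all add: h_add algebra_simps)

lemma ev_smult [simp]: "ev t (smult c p) = h c * ev t p"
  by (induction p) (simp_all add: h_mult algebra_simps)

lemma ev_mult [simp]: "ev t (p * q) = ev t p * ev t q"
  by (induction p) (simp_all add: algebra_simps)

lemma ev_power [simp]: "ev t (p ^ n) = ev t p ^ n"
  by (induction n) simp_all

lemma ev_minus [simp]: "ev t (- p) = - ev t p"
  using ev_add[of t p "- p"] by (simp add: eq_neg_iff_add_eq_0 add.commute)

lemma ev_diff [simp]: "ev t (p - q) = ev t p - ev t q"
  using ev_add[of t p "- q"] by simp

lemma ev_sum [simp]: "ev t (sum f A) = (\<Sum>i\<in>A. ev t (f i))"
  by (induction A rule: infinite_finite_induct) simp_all

lemma ev_monom [simp]: "ev t (monom c n) = h c * t ^ n"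
  by (induction n) (simp_all add: monom_0 monom_Suc)

lemma ev_eq_sum: "degree p \<le> n \<Longrightarrow> ev t p = (\<Sum>i\<le>n. h (coeff p i) * t ^ i)"
  by (subst poly_as_sum_of_monoms'[symmetric, of p n]) simp_all

lemma transcendental_iff: "transcendental_over h t \<longleftrightarrow> (\<forall>p. ev t p = 0 \<longrightarrow> p = 0)"
  unfolding transcendental_over_def ev_def by blast

lemma ev_eq_iff: "transcendental_over h t \<Longrightarrow> ev t p = ev t q \<longleftrightarrow> p = q"
  using ev_diff[of t p q] unfolding transcendental_iff by (metis eq_iff_diff_eq_0)

lemma subfield_overD:
  assumes "subfield_over h L"
  shows "h c \<in> L" "0 \<in> L" "1 \<in> L" "x \<in> L \<Longrightarrow> y \<in> L \<Longrightarrow> x + y \<in> L" "x \<in> L \<Longrightarrow> y \<in> L \<Longrightarrow> x * y \<in> L"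
    "x \<in> L \<Longrightarrow> - x \<in> L" "x \<in> L \<Longrightarrow> inverse x \<in> L"
    "x \<in> L \<Longrightarrow> y \<in> L \<Longrightarrow> x - y \<in> L" "x \<in> L \<Longrightarrow> y \<in> L \<Longrightarrow> x / y \<in> L" "x \<in> L \<Longrightarrow> x ^ n \<in> L"
proof -
  show *: "h c \<in> L" "0 \<in> L" "1 \<in> L"  "\<And>x y. x \<in> L \<Longrightarrow> y \<in> L \<Longrightarrow> x + y \<in> L" "\<And>x y. x \<in> L \<Longrightarrow> y \<in> L \<Longrightarrow> x * y \<in> L"
    "\<And>x. x \<in> L \<Longrightarrow> - x \<in> L" "\<And>x. x \<in> L \<Longrightarrow> inverse x \<in> L"
    using assms by (auto simp: subfield_over_def is_subfield_def)
  show "x \<in> L \<Longrightarrow> y \<in> L \<Longrightarrow> x - y \<in> L" "x \<in> L \<Longrightarrow> y \<in> L \<Longrightarrow> x / y \<in> L"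
    unfolding diff_conv_add_uminus divide_inverse by (intro *(4,5,6,7); assumption)+
  show "x \<in> L \<Longrightarrow> x ^ n \<in> L" by (induction n) (auto intro: *)
qed

lemma subfield_overI:
  assumes "\<And>c. h c \<in> L" "\<And>x y. x \<in> L \<Longrightarrow> y \<in> L \<Longrightarrow> x + y \<in> L" "\<And>x y. x \<in> L \<Longrightarrow> y \<in> L \<Longrightarrow> x * y \<in> L"
    "\<And>x. x \<in> L \<Longrightarrow> inverse x \<in> L"
  shows "subfield_over h L"
proof -
  have "0 \<in> L" "1 \<in> L" using assms(1)[of 0] assms(1)[of 1] by simp_all
  moreover have "- x \<in> L" if "x \<in> L" for x
    using that uminus_CHAR_2[OF char_top, of x] by (simp only:)
  ultimately show ?thesis using assms by (auto simp: subfield_over_def is_subfield_def)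
qed

lemma adjoin_induct:
  assumes "adjoin h {z, y} = UNIV" "subfield_over h L" "z \<in> L" "y \<in> L"
  shows "x \<in> L"
  using assms unfolding adjoin_def subfield_over_def by auto

lemma subfield_over_range: "subfield_over h (range h)"
proof (rule subfield_overI)
  fix x y assume "x \<in> range h" "y \<in> range h"
  then obtain a b where "x = h a" "y = h b" by auto
  thus "x + y \<in> range h" "x * y \<in> range h" by (metis h_add rangeI, metis h_mult rangeI)
next
  fix x assume "x \<in> range h"
  thus "inverse x \<in> range h" by (auto simp flip: h_inverse)
qed simp

lemma quadratic_adjoinI: "A \<in> L \<Longrightarrow> B \<in> L \<Longrightarrow> A + B * x \<in> quadratic_adjoin L x"
  unfolding quadratic_adjoin_def by blast

lemma quadratic_adjoinE:
  assumes "v \<in> quadratic_adjoin L x"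
  obtains A B where "v = A + B * x" "A \<in> L" "B \<in> L"
  using assms unfolding quadratic_adjoin_def by blast

text \<open>
  Since \<open>x^2\<close> and hence \<open>v^2\<close> lies in \<open>L\<close>, inverses come from \<open>v^(-1) = v / v^2\<close>; this also
  covers the case where \<open>x\<close> itself lies in \<open>L\<close>.
\<close>

lemma subfield_over_quadratic_adjoin:
  assumes L: "subfield_over h L" and x: "x^2 \<in> L"
  shows "subfield_over h (quadratic_adjoin L x)"
proof (rule subfield_overI)
  note D = subfield_overD[OF L]
  show "h c \<in> quadratic_adjoin L x" for c
    using quadratic_adjoinI[OF D(1) D(2), of c x] by simp
  fix v assume "v \<in> quadratic_adjoin L x"
  then obtain A B where v: "v = A + B * x" "A \<in> L" "B \<in> L" by (rule quadratic_adjoinE)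
  {
    fix w assume "w \<in> quadratic_adjoin L x"
    then obtain A' B' where w: "w = A' + B' * x" "A' \<in> L" "B' \<in> L" by (rule quadratic_adjoinE)
    have "v + w = (A + A') + (B + B') * x" unfolding v w by (simp add: algebra_simps)
    also have "\<dots> \<in> quadratic_adjoin L x" by (intro quadratic_adjoinI D(4) v w)
    finally show "v + w \<in> quadratic_adjoin L x" .
    have "v * w = (A * A' + B * B' * x^2) + (A * B' + B * A') * x"
      unfolding v w by (simp add: algebra_simps power2_eq_square)
    also have "\<dots> \<in> quadratic_adjoin L x" by (intro quadratic_adjoinI D(4,5) v w x)
    finally show "v * w \<in> quadratic_adjoin L x" .
  }
  have v2: "v^2 \<in> L" unfolding v square_add power_mult_distrib by (intro D(4,5,10) v x)
  have "inverse v = v / v^2" by (cases "v = 0") (simp_all add: power2_eq_square field_simps)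
  also have "\<dots> = A / v^2 + (B / v^2) * x" by (simp add: v(1) add_divide_distrib)
  also have "\<dots> \<in> quadratic_adjoin L x" by (intro quadratic_adjoinI D(9) v v2)
  finally show "inverse v \<in> quadratic_adjoin L x" .
qed

lemma quadratic_adjoin_mem:
  assumes "subfield_over h L"
  shows "x \<in> quadratic_adjoin L x" "a \<in> L \<Longrightarrow> a \<in> quadratic_adjoin L x"
  using quadratic_adjoinI[of 0 L 1 x] quadratic_adjoinI[of a L 0 x] subfield_overD(2,3)[OF assms] by simp_all

lemma quadratic_adjoin_unique:
  assumes L: "subfield_over h L" and "x \<notin> L" and "A \<in> L" "B \<in> L" "A' \<in> L" "B' \<in> L"
    and eq: "A + B * x = A' + B' * x"
  shows "A = A' \<and> B = B'"
proof -
  have "B = B'"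
  proof (rule ccontr)
    assume "B \<noteq> B'"
    hence "x = (A - A') / (B' - B)" using eq by (simp add: field_simps)
    moreover have "(A - A') / (B' - B) \<in> L" using assms subfield_overD[OF L] by simp
    ultimately show False using \<open>x \<notin> L\<close> by simp
  qed
  with eq show ?thesis by simp
qed

lemma quadratic_adjoin_square:
  assumes L: "subfield_over h L" and "x^2 \<in> L" and "v \<in> quadratic_adjoin L x"
  shows "v^2 \<in> L"
  using assms(3)
proof (rule quadratic_adjoinE)
  fix A B assume "v = A + B * x" "A \<in> L" "B \<in> L"
  thus "v^2 \<in> L" using subfield_overD(4,5,10)[OF L] assms(2) by (simp add: square_add power_mult_distrib)
qed

text \<open>
  This is the field \<open>K(F^n)\<close>.
\<close>

definition power_field :: "nat \<Rightarrow> 'f set" where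
  "power_field n = \<Inter> {L. subfield_over h L \<and> (\<forall>x. x ^ n \<in> L)}"

lemma power_fieldI:
  assumes "\<And>L. subfield_over h L \<Longrightarrow> (\<And>x. x ^ n \<in> L) \<Longrightarrow> v \<in> L"
  shows "v \<in> power_field n"
  using assms unfolding power_field_def by blast

lemma power_fieldD:
  assumes "v \<in> power_field n" "subfield_over h L" "\<And>x. x ^ n \<in> L"
  shows "v \<in> L"
  using assms unfolding power_field_def by blast

text \<open>
  This is the field \<open>K(t)\<close>, given by explicit quotients so that clearing denominators leads
  to identities between polynomials over \<open>K\<close>.
\<close>

definition ratfun :: "'f \<Rightarrow> 'f set" where
  "ratfun t = {ev t p / ev t q |p q. ev t q \<noteq> 0}"

lemma ratfun_I: "ev t q \<noteq> 0 \<Longrightarrow> ev t p / ev t q \<in> ratfun t"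
  unfolding ratfun_def by blast

lemma ev_in_ratfun [simp]: "ev t p \<in> ratfun t"
  using ratfun_I[of t 1 p] by simp

lemma generator_in_ratfun [simp]: "t \<in> ratfun t"
  using ev_in_ratfun[of t "[:0, 1:]"] by (simp del: ev_in_ratfun)

lemma subfield_over_ratfun: "subfield_over h (ratfun t)"
proof (rule subfield_overI)
  show "h c \<in> ratfun t" for c using ev_in_ratfun[of t "[:c:]"] by (simp del: ev_in_ratfun)
  fix x assume "x \<in> ratfun t"
  then obtain p q where x: "x = ev t p / ev t q" "ev t q \<noteq> 0" unfolding ratfun_def by auto
  {
    fix y assume "y \<in> ratfun t"
    then obtain p' q' where y: "y = ev t p' / ev t q'" "ev t q' \<noteq> 0" unfolding ratfun_def by auto
    have "x + y = ev t (p * q' + p' * q) / ev t (q * q')" "x * y = ev t (p * p') / ev t (q * q')"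
      using x(2) y(2) unfolding x(1) y(1) by (simp_all add: field_simps)
    moreover have "ev t (q * q') \<noteq> 0" using x y by simp
    ultimately show "x + y \<in> ratfun t" "x * y \<in> ratfun t" using ratfun_I by presburger+
  }
  show "inverse x \<in> ratfun t"
  proof (cases "x = 0")
    case True
    thus ?thesis using ev_in_ratfun[of t 0] by (simp del: ev_in_ratfun)
  next
    case False
    hence "ev t p \<noteq> 0" "inverse x = ev t q / ev t p" using x by auto
    thus ?thesis using ratfun_I by simp
  qed
qed

lemma ev_in_subfield:
  assumes "subfield_over h L" "t \<in> L"
  shows "ev t p \<in> L"
  by (induction p) (use assms subfield_overD[OF assms(1)] in simp_all)

lemma ratfun_minimal:
  assumes "subfield_over h L" "t \<in> L"
  shows "ratfun t \<subseteq> L"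
  unfolding ratfun_def using ev_in_subfield[OF assms] subfield_overD(9)[OF assms(1)] by auto

lemma common_denominator:
  assumes "x \<in> ratfun t" "y \<in> ratfun t"
  shows "\<exists>p r q. x = ev t p / ev t q \<and> y = ev t r / ev t q \<and> ev t q \<noteq> 0"
proof -
  obtain p q p' q' where *: "x = ev t p / ev t q" "ev t q \<noteq> 0" "y = ev t p' / ev t q'" "ev t q' \<noteq> 0"
    using assms unfolding ratfun_def by blast
  hence "x = ev t (p * q') / ev t (q * q')" "y = ev t (p' * q) / ev t (q * q')" "ev t (q * q') \<noteq> 0"
    by simp_all
  thus ?thesis by blast
qed

text \<open>
  With a common denominator \<open>q\<close>, \<open>R\<^sub>0 = f / q\<close> and \<open>R\<^sub>1 = g / q\<close>, the derivative of
  \<open>X q^2 = f^2 + g^2 Y\<close> is \<open>X' q^2 = e g^2\<close>. So \<open>X' / e\<close> is the square of \<open>g / q\<close>, which makes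
  \<open>R\<^sub>1\<close> a polynomial, and then \<open>R\<^sub>0\<close> is one as well.
\<close>

lemma polynomial_from_square_sum:
  assumes t: "transcendental_over h t" and R: "R0 \<in> ratfun t" "R1 \<in> ratfun t"
    and dY: "pderiv Y = [:e:]" and e: "e \<noteq> 0" and eq: "ev t X = R0^2 + R1^2 * ev t Y"
  shows "\<exists>k0 k1. R0 = ev t k0 \<and> R1 = ev t k1 \<and> X = k0^2 + k1^2 * Y"
proof -
  have char': "CHAR('k poly) = 2" using char by simp
  obtain f g q where R0: "R0 = ev t f / ev t q" and R1: "R1 = ev t g / ev t q" and q: "ev t q \<noteq> 0"
    using common_denominator[OF R] by blast
  hence "ev t (X * q^2) = ev t (f^2 + g^2 * Y)"
    unfolding ev_mult ev_add ev_power eq by (simp add: power_mult_distrib add_divide_distrib power_divide distrib_right)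
  hence pq: "X * q^2 = f^2 + g^2 * Y" using ev_eq_iff[OF t] by blast
  have "q \<noteq> 0" using q by auto
  have "pderiv X * q^2 = smult e (g^2)"
    using arg_cong[OF pq, of pderiv]
    by (simp add: pderiv_add pderiv_mult pderiv_square_char_two[OF char] dY mult.commute)
  hence "smult (inverse e) (pderiv X) * q^2 = g^2" using e by simp
  from square_quotient_imp_square[OF char this \<open>q \<noteq> 0\<close>] obtain k1 where k1: "g = k1 * q" by blast
  have "f^2 = X * q^2 + g^2 * Y" using pq by (rule sum_eqD_char_two[OF char'])
  hence "(X + k1^2 * Y) * q^2 = f^2" by (simp add: k1 algebra_simps)
  from square_quotient_imp_square[OF char this \<open>q \<noteq> 0\<close>] obtain k0 where
    k0: "X + k1^2 * Y = k0^2" "f = k0 * q" by blast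
  have "X = k0^2 + k1^2 * Y"
    using sum_eqD_char_two[OF char', of "k0^2" X "k1^2 * Y"] k0 by simp
  moreover have "R0 = ev t k0" "R1 = ev t k1" using q by (simp_all add: R0 R1 k0 k1)
  ultimately show ?thesis by blast
qed

lemma not_square_in_ratfun:
  assumes t: "transcendental_over h t" and dY: "pderiv Y \<noteq> 0" and "x^2 = ev t Y"
  shows "x \<notin> ratfun t"
proof
  assume "x \<in> ratfun t"
  then obtain f q where x: "x = ev t f / ev t q" and q: "ev t q \<noteq> 0" unfolding ratfun_def by blast
  hence "ev t (Y * q^2) = ev t (f^2)" using assms(3)[symmetric] by (simp add: power_divide)
  hence "Y * q^2 = f^2" using ev_eq_iff[OF t] by blast
  moreover have "q \<noteq> 0" using q by auto
  ultimately obtain k where "Y = k^2" using square_quotient_imp_square[OF char] by blast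
  thus False using dY pderiv_square_char_two[OF char] by simp
qed

text \<open>
  Write \<open>t' = p(t) / q(t)\<close> in lowest terms and \<open>t = P(t') / Q(t')\<close>. Substituting the first
  into the second and clearing denominators gives the homogeneous relation
  \<open>\<Sum> (Q\<^sub>i t - P\<^sub>i) p^i q^(n - i) = 0\<close>. Its coefficients are polynomials of degree at most
  one, and \<open>p\<close> and \<open>q\<close> each divide a nonzero one of them.
\<close>

lemma generators_of_rational_function_field:
  assumes t: "transcendental_over h t" and t': "t' \<in> ratfun t" and tback: "t \<in> ratfun t'"
  shows "\<exists>\<alpha> \<beta> \<gamma> \<delta>. (\<gamma> = 0 \<and> \<delta> = 1 \<or> \<gamma> = 1) \<and> \<alpha> * \<delta> \<noteq> \<beta> * \<gamma> \<and> ev t [:\<delta>, \<gamma>:] \<noteq> 0 \<and>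
           t' = ev t [:\<beta>, \<alpha>:] / ev t [:\<delta>, \<gamma>:]"
proof -
  obtain p0 q0 where t'0: "t' = ev t p0 / ev t q0" "ev t q0 \<noteq> 0" using t' unfolding ratfun_def by blast
  obtain g p q a b where pq: "p0 = g * p" "q0 = g * q" and bez: "a * p + b * q = 1"
    using bezout_reduced_fraction by blast
  have evq: "ev t q \<noteq> 0" and t'pq: "t' = ev t p / ev t q" using t'0 by (auto simp: pq)
  hence "q \<noteq> 0" by auto
  obtain P Q where tPQ: "t = ev t' P / ev t' Q" "ev t' Q \<noteq> 0" using tback unfolding ratfun_def by blast
  define n where "n = max (degree P) (degree Q)"
  define R where "R i = [:- coeff P i, coeff Q i:]" for i
  have rel: "(\<Sum>i\<le>n. R i * p ^ i * q ^ (n - i)) = 0"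
  proof -
    have *: "ev t q ^ n * t' ^ i = ev t p ^ i * ev t q ^ (n - i)" if "i \<le> n" for i
      using that evq by (simp add: t'pq power_divide power_diff)
    hence "ev t (\<Sum>i\<le>n. R i * p ^ i * q ^ (n - i)) = 
        (\<Sum>i\<le>n. (t * h (coeff Q i) - h (coeff P i)) * (ev t q ^ n * t' ^ i))"
      unfolding ev_sum by (intro sum.cong refl) (simp add: * R_def h_minus algebra_simps)
    also have "\<dots> = ev t q ^ n * (t * (\<Sum>i\<le>n. h (coeff Q i) * t' ^ i) - (\<Sum>i\<le>n. h (coeff P i) * t' ^ i))"
      by (simp add: sum_distrib_left sum_subtractf algebra_simps)
    also have "\<dots> = ev t q ^ n * (t * ev t' Q - ev t' P)"
      by (simp add: ev_eq_sum[of Q n] ev_eq_sum[of P n] n_def)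
    also have "\<dots> = 0" using tPQ by (simp add: field_simps)
    finally show ?thesis using t unfolding transcendental_iff by blast
  qed
  have "Q \<noteq> 0" using tPQ by auto
  hence nz: "\<exists>i\<le>n. R i \<noteq> 0" unfolding R_def n_def
    by (intro exI[of _ "degree Q"]) auto
  have "degree (R i) \<le> 1" for i by (simp add: R_def)
  hence deg: "degree r \<le> 1" if "R i \<noteq> 0" "r dvd R i" for r i
    using dvd_imp_degree_le[OF that(2,1)] le_trans by blast
  have q1: "degree q \<le> 1"
    using dvd_coefficient_of_homogeneous_relation[OF bez \<open>q \<noteq> 0\<close> rel nz] deg by blast
  have p1: "degree p \<le> 1"
  proof (cases "p = 0")
    case False
    have "(\<Sum>i\<le>n. R (n - i) * q ^ i * p ^ (n - i)) = (\<Sum>i\<le>n. R i * p ^ i * q ^ (n - i))"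
      by (rule sum.reindex_bij_witness[of _ "\<lambda>i. n - i" "\<lambda>i. n - i"]) (auto simp: mult_ac)
    hence "(\<Sum>i\<le>n. R (n - i) * q ^ i * p ^ (n - i)) = 0" using rel by simp
    moreover have "\<exists>i\<le>n. R (n - i) \<noteq> 0" using nz by (metis diff_diff_cancel diff_le_self)
    moreover have "b * q + a * p = 1" using bez by (simp add: add.commute)
    ultimately have "\<exists>i\<le>n. R (n - i) \<noteq> 0 \<and> p dvd R (n - i)"
      using dvd_coefficient_of_homogeneous_relation[where R = "\<lambda>i. R (n - i)", OF _ False] by blast
    thus ?thesis using deg by blast
  qed simp
  have linear: "\<exists>x y. r = [:x, y:]" if "degree r \<le> 1" for r :: "'k poly"
  proof -
    have "r = [:coeff r 0, coeff r 1:]"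
      using that by (intro poly_eqI) (auto simp: coeff_pCons intro!: coeff_eq_0 split: nat.splits)
    thus ?thesis by blast
  qed
  obtain \<beta>0 \<alpha>0 where p: "p = [:\<beta>0, \<alpha>0:]" using linear[OF p1] by blast
  obtain \<delta>0 \<gamma>0 where q: "q = [:\<delta>0, \<gamma>0:]" using linear[OF q1] by blast
  \<comment> \<open>The scaling factor that turns the denominator into \<open>1\<close> or a monic polynomial.\<close>
  define s where "s = (if \<gamma>0 = 0 then \<delta>0 else \<gamma>0)"
  have "s \<noteq> 0" using \<open>q \<noteq> 0\<close> q by (auto simp: s_def)
  define \<alpha> \<beta> \<gamma> \<delta> where "\<alpha> = \<alpha>0 / s" and "\<beta> = \<beta>0 / s" and "\<gamma> = \<gamma>0 / s" and "\<delta> = \<delta>0 / s"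
  have norm: "\<gamma> = 0 \<and> \<delta> = 1 \<or> \<gamma> = 1" using \<open>s \<noteq> 0\<close> by (auto simp: \<gamma>_def \<delta>_def s_def)
  have pq': "p = smult s [:\<beta>, \<alpha>:]" "q = smult s [:\<delta>, \<gamma>:]"
    using \<open>s \<noteq> 0\<close> by (simp_all add: p q \<alpha>_def \<beta>_def \<gamma>_def \<delta>_def)
  have M: "ev t [:\<delta>, \<gamma>:] \<noteq> 0" using evq unfolding pq' by (metis ev_smult mult_zero_right)
  have t'eq: "t' = ev t [:\<beta>, \<alpha>:] / ev t [:\<delta>, \<gamma>:]"
    using \<open>s \<noteq> 0\<close> unfolding t'pq pq' ev_smult by simp
  have "\<alpha> * \<delta> \<noteq> \<beta> * \<gamma>"
  proof
    assume det: "\<alpha> * \<delta> = \<beta> * \<gamma>"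
    have "t' \<in> range h"
    proof (cases "\<gamma> = 1")
      case True
      have "\<beta> = \<alpha> * \<delta>" using det True by simp
      hence "t' = h \<alpha>" unfolding t'eq using M by (simp add: True h_mult field_simps)
      thus ?thesis by simp
    next
      case False
      with norm have "\<gamma> = 0" "\<delta> = 1" by auto
      with det have "\<alpha> = 0" by simp
      thus ?thesis unfolding t'eq using \<open>\<gamma> = 0\<close> \<open>\<delta> = 1\<close> by simp
    qed
    hence "t \<in> range h" using ratfun_minimal[OF subfield_over_range] tback by blast
    then obtain x where "t = h x" by blast
    hence "ev t [:- x, 1:] = 0" by (simp add: h_minus)
    thus False using t unfolding transcendental_iff by fastforce
  qed
  with norm M t'eq show ?thesis by blast
qed

text \<open>
  If \<open>t\<close> is a root of a polynomial of degree \<open>m\<close> and \<open>s = f(t) / g(t)\<close>, then the \<open>m + 1\<close>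
  elements \<open>s^i g(t)^m\<close> with \<open>i \<le> m\<close> are polynomials in \<open>t\<close>, hence they lie in the span of
  \<open>1, t, \<dots>, t^(m-1)\<close> and are linearly dependent.
\<close>

lemma algebraic_ratfun:
  assumes t: "\<not> transcendental_over h t" and s: "s \<in> ratfun t"
  shows "\<not> transcendental_over h s"
proof
  assume trans: "transcendental_over h s"
  interpret V: vector_space "\<lambda>c x. h c * x"
    by unfold_locales (simp_all add: h_add h_mult algebra_simps)
  obtain p where p: "ev t p = 0" "p \<noteq> 0" using t unfolding transcendental_iff by blast
  obtain f g where fg: "s = ev t f / ev t g" "ev t g \<noteq> 0" using s unfolding ratfun_def by blast
  define m where "m = degree p"
  define T where "T = (\<lambda>i. t ^ i) ` {..<m}"
  have "ev t r \<in> V.span T" for r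
  proof -
    have "m > 0"
    proof (rule ccontr)
      assume "\<not> m > 0"
      then obtain c where "p = [:c:]" by (metis m_def degree_eq_zeroE gr0I)
      with p show False by simp
    qed
    have "ev t r = ev t (r div p * p + r mod p)" by simp
    also have "\<dots> = ev t (r mod p)" by (simp only: ev_add ev_mult p) simp
    also have "degree (r mod p) \<le> m - 1"
      using degree_mod_less[OF p(2), of r] by (auto simp: m_def)
    hence "ev t (r mod p) = (\<Sum>i\<le>m - 1. h (coeff (r mod p) i) * t ^ i)" by (rule ev_eq_sum)
    also have "\<dots> \<in> V.span T"
      using \<open>m > 0\<close> by (intro V.span_sum V.span_scale V.span_base) (auto simp: T_def)
    finally show ?thesis .
  qed note span = this
  define v where "v i = s ^ i * ev t g ^ m" for i
  have v: "v i \<in> V.span T" if "i \<le> m" for i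
  proof -
    have "v i = ev t (f ^ i * g ^ (m - i))"
      using that fg by (simp add: v_def power_divide power_diff)
    thus ?thesis by (simp only: span)
  qed
  have inj: "inj_on v {..m}"
  proof
    fix i j assume "v i = v j"
    hence "ev s (monom 1 i) = ev s (monom 1 j)" using fg by (simp add: v_def)
    hence "monom (1::'k) i = monom 1 j" using ev_eq_iff[OF trans] by blast
    thus "i = j" by (metis degree_monom_eq one_neq_zero)
  qed
  have "V.independent (v ` {..m})"
  proof
    assume "V.dependent (v ` {..m})"
    then obtain u where u: "\<exists>x\<in>v ` {..m}. u x \<noteq> 0" "(\<Sum>x\<in>v ` {..m}. h (u x) * x) = 0"
      by (auto simp: V.dependent_finite)
    define r where "r = (\<Sum>i\<le>m. monom (u (v i)) i)"
    have "ev s r * ev t g ^ m = (\<Sum>i\<le>m. h (u (v i)) * v i)"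
      by (simp add: r_def v_def sum_distrib_left mult_ac)
    also have "\<dots> = 0" using u(2) by (simp add: sum.reindex[OF inj])
    finally have "r = 0" using fg trans unfolding transcendental_iff by simp
    moreover have "coeff r i = u (v i)" if "i \<le> m" for i
      using that by (simp add: r_def coeff_sum)
    ultimately show False using u(1) by auto
  qed
  moreover have "finite T" "card T \<le> m" unfolding T_def using card_image_le[of "{..<m}"] by auto
  moreover have "v ` {..m} \<subseteq> V.span T" using v by blast
  ultimately have "card (v ` {..m}) \<le> m" using V.independent_span_bound by (meson le_trans)
  thus False by (simp add: card_image[OF inj])
qed

lemma transcendental_square:
  assumes "transcendental_over h z"
  shows "transcendental_over h (z^2)"
  unfolding transcendental_iff
proof (intro allI impI)
  fix p assume "ev (z^2) p = 0"
  moreover have "ev (z^2) p = ev z (pcompose p [:0, 0, 1:])"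
    by (induction p) (simp_all add: pcompose_pCons power2_eq_square algebra_simps)
  ultimately have "pcompose p [:0, 0, 1:] = 0" using assms unfolding transcendental_iff by simp
  thus "p = 0" by (rule pcompose_eq_0) simp
qed

end

section \<open>Type (a)\<close>

text \<open>
  Here \<open>t' = L / M\<close> has a pole at \<open>t = \<delta>\<close>, and \<open>N'\<close> is \<open>b' t'^2 + t' + d'\<close> times \<open>M^2\<close>. The
  equation expresses that \<open>z'\<close> lies in \<open>K(t)(z)\<close>. Its left side has a derivative divisible
  by \<open>M^2\<close>, whereas the derivative of \<open>Q\<close> is a nonzero constant; so \<open>k\<close> vanishes at \<open>\<delta>\<close>, and
  evaluation at \<open>\<delta>\<close> makes \<open>a'\<close> a square. Geometrically, the regular curve with function field
  \<open>K(t)(z) = K(t')(z')\<close> is smooth at all finite values of \<open>t\<close>, but not at the pole of \<open>t'\<close>.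
\<close>

lemma type_a_affine:
  fixes S k :: "'k::field poly" and a b c d a' b' c' d' \<alpha> \<beta> \<delta> :: 'k
  assumes char: "CHAR('k) = 2" and "a' \<notin> squares" "b' \<noteq> 0" "b \<noteq> 0" "c \<noteq> 0"
  defines "N \<equiv> [:d, 1, b:]"
  defines "L \<equiv> [:\<beta>, \<alpha>:]" and "M \<equiv> [:\<delta>, 1:]"
  defines "N' \<equiv> smult b' (L^2) + L * M + smult d' (M^2)"
  defines "Q \<equiv> smult a (N^2) + smult (b^2 * c^3) N"
  assumes det: "\<alpha> * \<delta> \<noteq> \<beta>"
    and eq: "smult a' (N'^2) + smult (b'^2 * c'^3) (M^2 * N') = S^2 + k^2 * Q"
  shows False
proof -
  note [simp] = pderiv_add pderiv_smult pderiv_mult pderiv_square_char_two[OF char] pderiv_pCons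
    add_self_char_two[OF char] 
  have M: "poly M \<delta> = 0" by (simp add: M_def)
  have dQ: "pderiv Q = [:b^2 * c^3:]" by (simp add: Q_def N_def)
  have "poly (pderiv (smult a' (N'^2) + smult (b'^2 * c'^3) (M^2 * N'))) \<delta> = 0"
    by (simp add: M)
  hence "(poly k \<delta>)^2 * (b^2 * c^3) = 0"
    unfolding eq by (auto simp: dQ)
  hence k: "poly k \<delta> = 0" using assms by simp
  define l where "l = \<beta> + \<alpha> * \<delta>"
  have "l \<noteq> 0" using det by (metis l_def add_self_char_two char add.commute add_right_cancel)
  have N': "poly N' \<delta> = b' * l^2" by (simp add: N'_def M) (simp add: L_def l_def mult.commute)
  have "a' * (b' * l^2)^2 = (poly S \<delta>)^2"
    using arg_cong[OF eq, of "\<lambda>p. poly p \<delta>"] by (simp add: M k N')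
  hence "a' = (poly S \<delta> / (b' * l^2))^2"
    using \<open>l \<noteq> 0\<close> \<open>b' \<noteq> 0\<close> by (simp add: field_simps)
  thus False using \<open>a' \<notin> squares\<close> by blast
qed

text \<open>
  The affine case \<open>t' = \<alpha> t + \<beta>\<close>. The first equation says that \<open>z'\<close> lies in \<open>K(t)(z)\<close>, the
  other two that \<open>y'\<close> lies in \<open>K(t)(z, y)\<close>; they hold with
  \<open>z' = (S + k N z) / N'\<close>, where \<open>N\<close> and \<open>N'\<close> are the denominators of \<open>u\<close> and \<open>u'\<close>.
  The polynomial \<open>k\<close> turns out to be a constant \<open>e\<close> with \<open>e^2 b c^3 = b' c'^3\<close>, and the last
  equation yields \<open>e = 1\<close>.
\<close>

lemma type_a_core:
  fixes S k :: "'k::field poly" and a b c d a' b' c' d' \<alpha> \<beta> :: 'k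
  assumes char: "CHAR('k) = 2" and nsq: "a \<notin> squares" and nz: "b' \<noteq> 0" "b \<noteq> 0" "c \<noteq> 0" "c' \<noteq> 0" "\<alpha> \<noteq> 0"
  defines "N \<equiv> [:d, 1, b:]"
  defines "L \<equiv> [:\<beta>, \<alpha>:]"
  defines "N' \<equiv> smult b' (L^2) + L + [:d':]"
  defines "Q \<equiv> smult a (N^2) + smult (b^2 * c^3) N"
  assumes eq1: "smult a' (N'^2) + smult (b'^2 * c'^3) N' = S^2 + k^2 * Q"
    and eq2: "k * N * N' = k0^2 + k1^2 * Q"
    and eq3: "N' * (S + smult (b'^2 * c'^3) L + smult (b^2 * c^3) (k * [:0, 1:])) = l0^2 + l1^2 * Q"
  shows "b * c^3 = b' * c'^3 \<and> (a = a' \<and> b = b' \<and> c = c' \<and> d = d' \<longrightarrow> \<alpha> = 1 \<and> \<beta> = 0)"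
proof -
  note [simp] = pderiv_add pderiv_smult pderiv_mult pderiv_square_char_two[OF char] pderiv_pCons
    add_self_char_two[OF char] 
  note two [simp] = char_two_eq_zero[OF char]
  define n where "n = b' * \<beta>^2 + \<beta> + d'"
  have N': "N' = [:n, \<alpha>, b' * \<alpha>^2:]"
    by (simp add: N'_def L_def square_pCons_char_two[OF char] n_def)
  have Q: "Q = [:a * d^2 + b^2 * c^3 * d, b^2*c^3, a + b^3 * c^3, 0, a * b^2:]"
    by (simp add: Q_def N_def square_pCons_char_two[OF char] algebra_simps power_numeral_reduce)
  have dQ: "pderiv Q = [:b^2 * c^3:]" by (simp add: Q_def N_def)
  have dN': "pderiv N' = [:\<alpha>:]" by (simp add: N')
  have dN: "pderiv N = [:1:]" by (simp add: N_def)
  have "smult (b^2 * c^3) (k^2) = [:\<alpha> * (b'^2 * c'^3):]"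
    using arg_cong[OF eq1, of pderiv] by (simp add: dQ dN' mult_ac)
  then obtain e where k: "k = [:e:]" and e: "\<alpha> * (b'^2 * c'^3) = b^2 * c^3 * e^2"
    using smult_square_eq_const[OF char, of "b^2 * c^3" k] nz by auto
  have "e \<noteq> 0" using e nz by auto
  have "smult (b^2 * c^3) (k1^2) = pderiv (k * N * N')" unfolding eq2 by (simp add: dQ)
  also have "\<dots> = [:e * (n + \<alpha> * d), 0, e * (b' * \<alpha>^2 + \<alpha> * b):]"
    by (simp add: dN dN' k) (simp add: N' N_def algebra_simps)
  finally obtain p q where k1: "k1 = [:p, q:]" and p: "e * (n + \<alpha> * d) = b^2 * c^3 * p^2"
    and q: "e * (b' * \<alpha>^2 + \<alpha> * b) = b^2 * c^3 * q^2"
    using smult_square_eq_linear[OF char, of "b^2 * c^3" k1] nz by auto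
  note move = sum_eqD_char_two[where 'a = "'k poly", unfolded semiring_char_poly, OF char]
  \<comment> \<open>The coefficients at \<open>t^6\<close> and \<open>t^4\<close> are those of interest.\<close>
  have "k0^2 = k * N * N' + k1^2 * Q" using eq2 by (rule move)
  also have "\<dots> = [:e * d * n + p^2 * (a * d^2 + b^2 * c^3 * d),
                     e * n + \<alpha> * d * e + b^2 * c^3 * p^2,
                     e * (b * n + \<alpha> + d * b' * \<alpha>^2) + p^2 * (a + b^3 * c^3) + q^2 * (a * d^2 + b^2 * c^3 * d),
                     e * \<alpha> * (b + b' * \<alpha>) + q^2 * (b^2 * c^3),
                     e * b * b' * \<alpha>^2 + p^2 * (a * b^2) + q^2 * (a + b^3 * c^3), 0, q^2 * (a * b^2):]"
    by (simp add: k N_def N' k1 Q square_pCons_char_two[OF char] algebra_simps power2_eq_square)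
  finally obtain k02 k03 where k02: "e * b * b' * \<alpha>^2 + p^2 * (a * b^2) + q^2 * (a + b^3 * c^3) = k02^2"
    and k03: "q^2 * (a * b^2) = k03^2"
    using square_eq_coeffs[OF char] by blast
  have "a * (q * b)^2 = k03^2" using k03 by (simp add: power_mult_distrib mult_ac)
  hence "q = 0" using nonsquare_mult_square[OF nsq] nz by fastforce
  have "e * \<alpha> * (b' * \<alpha> + b) = 0" using q \<open>q = 0\<close> by (simp add: algebra_simps power2_eq_square)
  hence "b' * \<alpha> + b = 0" using nz \<open>e \<noteq> 0\<close> by simp
  \<comment> \<open>This makes the quadratic coefficient of \<open>N'\<close> equal to \<open>b \<alpha>\<close>.\<close>
  hence b: "b = b' * \<alpha>" by (rule sum_eq_zeroD_char_two[OF char, symmetric])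
  have "S^2 = smult a' (N'^2) + smult (b'^2 * c'^3) N' + k^2 * Q" using eq1 by (rule move)
  also have "\<dots> = [:a' * n^2 + b'^2 * c'^3 * n + e^2 * (a * d^2 + b^2 * c^3 * d),
      b'^2 * c'^3 * \<alpha> + e^2 * b^2 * c^3,
      a' * \<alpha>^2 + b'^2 * c'^3 * b' * \<alpha>^2 + e^2 * (a + b^3 * c^3), 0,
      a' * (b' * \<alpha>^2)^2 + e^2 * a * b^2, 0, 0:]"
    by (simp add: k N' Q square_pCons_char_two[OF char] algebra_simps)
  finally obtain s0 s1 s2 s3 where S: "S = [:s0, s1, s2, s3:]"
    and s0: "a' * n^2 + b'^2 * c'^3 * n + e^2 * (a * d^2 + b^2 * c^3 * d) = s0^2"
    and s1: "a' * \<alpha>^2 + b'^2 * c'^3 * b' * \<alpha>^2 + e^2 * (a + b^3 * c^3) = s1^2"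
    and s2: "a' * (b' * \<alpha>^2)^2 + e^2 * a * b^2 = s2^2" and s3: "0 = s3^2"
    using square_eq_coeffs[OF char] by blast
  have "s3 = 0" using s3 by simp
  have s1': "s1^2 = a' * \<alpha>^2 + e^2 * a"
  proof -
    have "b'^2 * c'^3 * b' * \<alpha>^2 = e^2 * (b^3 * c^3)" using e b by algebra
    thus ?thesis using s1 by (simp add: algebra_simps)
  qed
  have "s2^2 = (b * s1)^2" using s2 s1' b by algebra
  hence "s2 = b * s1" using square_eq_iff_char_two[OF char] by blast
  with S \<open>s3 = 0\<close> have S: "S = [:s0, s1, b * s1:]" by simp
  define \<kappa> where "\<kappa> = s0 + \<beta> * (b'^2 * c'^3)"
  \<comment> \<open>The coefficient \<open>e^2 + e\<close>, whose vanishing is the aim, arises from \<open>\<alpha> b'^2 c'^3 = e^2 b^2 c^3\<close>.\<close>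
  define \<eta> where "\<eta> = s1 + (e^2 + e) * (b^2 * c^3)"
  have X: "S + smult (b'^2 * c'^3) L + smult (b^2 * c^3) (k * [:0, 1:]) = [:\<kappa>, \<eta>, b * s1:]"
    using e by (simp add: S L_def k \<kappa>_def \<eta>_def algebra_simps)
  have "smult (b^2 * c^3) (l1^2) = pderiv (N' * [:\<kappa>, \<eta>, b * s1:])"
    unfolding X[symmetric] eq3 by (simp add: dQ)
  also have "\<dots> = [:\<alpha> * \<kappa> + n * \<eta>, 0, \<alpha> * b * s1 + b' * \<alpha>^2 * \<eta>:]"
    by (simp add: dN') (simp add: N' algebra_simps)
  finally obtain r w where l1: "l1 = [:r, w:]" and r: "\<alpha> * \<kappa> + n * \<eta> = b^2 * c^3 * r^2"
    and w: "\<alpha> * b * s1 + b' * \<alpha>^2 * \<eta> = b^2 * c^3 * w^2"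
    using smult_square_eq_linear[OF char, of "b^2 * c^3" l1] nz by auto
  have "l0^2 = N' * [:\<kappa>, \<eta>, b * s1:] + l1^2 * Q" using eq3 unfolding X by (rule move)
  also have "\<dots> = [:n * \<kappa> + r^2 * (a * d^2 + b^2 * c^3 * d),
        n * \<eta> + \<alpha> * \<kappa> + r^2 * b^2 * c^3,
        n * b * s1 + \<alpha> * \<eta> + b' * \<alpha>^2 * \<kappa> + r^2 * (a + b^3 * c^3) + w^2 * (a * d^2 + b^2 * c^3 * d),
        \<alpha> * b * s1 + b' * \<alpha>^2 * \<eta> + w^2 * b^2 * c^3,
        b' * \<alpha>^2 * b * s1 + r^2 * a * b^2 + w^2 * (a + b^3 * c^3), 0,
        w^2 * a * b^2:]"
    by (simp add: N' l1 Q square_pCons_char_two[OF char] algebra_simps)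
  finally obtain l02 l03 where
    l02: "b' * \<alpha>^2 * b * s1 + r^2 * a * b^2 + w^2 * (a + b^3 * c^3) = l02^2"
    and l03: "w^2 * a * b^2 = l03^2"
    using square_eq_coeffs[OF char] by blast
  have "a * (w * b)^2 = l03^2" using l03 by (simp add: power_mult_distrib mult_ac)
  hence "w = 0" using nonsquare_mult_square[OF nsq] nz by fastforce
  have "\<alpha> * b * s1 + b' * \<alpha>^2 * \<eta> = 2 * (\<alpha> * b * s1) + \<alpha> * b * (e * (e + 1)) * (b^2 * c^3)"
    using b \<eta>_def by algebra
  hence "\<alpha> * b * (e * (e + 1)) * (b^2 * c^3) = 0"
    using w \<open>w = 0\<close> by simp
  hence "e + 1 = 0" using nz \<open>e \<noteq> 0\<close> by simp
  hence "e = 1" by (rule sum_eq_zeroD_char_two[OF char])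
  show ?thesis
  proof (intro conjI impI)
    have "b * (b * c^3) = b * (b' * c'^3)" using e \<open>e = 1\<close> b by algebra
    thus "b * c^3 = b' * c'^3" using nz by simp
  next
    assume same: "a = a' \<and> b = b' \<and> c = c' \<and> d = d'"
    with b nz show "\<alpha> = 1" by simp
    have "k02^2 + b^2 = a * (p * b)^2 + 2 * b^2"
      using k02 \<open>q = 0\<close> \<open>e = 1\<close> same \<open>\<alpha> = 1\<close> by algebra
    hence "a * (p * b)^2 = (k02 + b)^2"
      unfolding square_add_char_two[OF char] by simp
    hence "p = 0" using nonsquare_mult_square[OF nsq] nz by fastforce
    hence "n + d = 0" using p \<open>e = 1\<close> \<open>\<alpha> = 1\<close> by simp
    hence n: "n = d" by (rule sum_eq_zeroD_char_two[OF char])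
    have "s1^2 = 0" using s1' same \<open>\<alpha> = 1\<close> \<open>e = 1\<close> by simp
    hence "s1 = 0" by simp
    have "s0^2 = 0" using s0 same n \<open>e = 1\<close> by simp
    hence "s0 = 0" by simp
    have "r^2 = \<beta>"
    proof -
      have "b^2 * c^3 * r^2 = b^2 * c^3 * \<beta>"
        using r \<open>s0 = 0\<close> \<open>s1 = 0\<close> \<open>e = 1\<close> \<open>\<alpha> = 1\<close> same by (auto simp add: \<kappa>_def \<eta>_def)
      thus ?thesis using nz by simp
    qed
    have "a * (r * b)^2 = l02^2"
      using l02 \<open>s1 = 0\<close> \<open>w = 0\<close> by (simp add: power_mult_distrib mult_ac)
    hence "r = 0" using nonsquare_mult_square[OF nsq] nz by fastforce
    thus "\<beta> = 0" using \<open>r^2 = \<beta>\<close> by simp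
  qed
qed

context char_two_extension
begin

text \<open>
  With \<open>s = y^2 + z\<close> and \<open>u = z^2 + a\<close> the quartic becomes the conic
  \<open>d u^2 + s u + b s^2 = b^2 c^3 u\<close> through the origin, which \<open>t = s / u\<close> parametrizes.
  The equation is linear in \<open>z\<close> over \<open>K(F^2)\<close>, which places \<open>z\<close> in \<open>K(F^2)\<close>; applying the
  Frobenius map to it places \<open>z^2\<close>, hence \<open>u\<close>, in \<open>K(F^4)\<close>, and the conic then does the same
  for \<open>s\<close>.
\<close>

lemma type_a_tower:
  assumes gen: "adjoin h {z, y} = UNIV" and tr: "transcendental_over h z"
    and rel: "quartic_a (h a) (h b) (h c) (h d) z y = 0" and nz: "b \<noteq> 0" "c \<noteq> 0"
  obtains t u where "transcendental_over h t" "z^2 = h a + u" "y^2 = z + t * u"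
    "u * ev t [:d, 1, b:] = h (b^2 * c^3)"
    "u \<in> ratfun t"
    "\<forall>x. x \<in> quadratic_adjoin (quadratic_adjoin (ratfun t) z) y"
    "\<forall>x. x^2 \<in> quadratic_adjoin (ratfun t) z" "\<forall>x. x^4 \<in> ratfun t"
    "z \<in> power_field 2"
    "t \<in> power_field 4"
proof -
  define u where "u = z^2 + h a"
  define s where "s = y^2 + z"
  define t where "t = s / u"
  have "u = ev z [:a, 0, 1:]" by (simp add: u_def power2_eq_square)
  hence "u \<noteq> 0" using tr unfolding transcendental_iff by (metis pCons_eq_0_iff one_neq_zero)
  hence s: "s = t * u" by (simp add: t_def)
  have z2: "z^2 = h a + u" using sum_eqD_char_two[OF char_top u_def] by (simp add: add.commute)
  have y2: "y^2 = z + t * u" using sum_eqD_char_two[OF char_top s_def] s by (simp add: add.commute)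
  have u2: "u^2 = z^4 + (h a)^2" by (simp add: u_def square_add flip: power_mult)
  have s2: "s^2 = y^4 + z^2" by (simp add: s_def square_add flip: power_mult)
  have "(h d * u^2 + s * u + h b * s^2) + h (b^2 * c^3) * u = quartic_a (h a) (h b) (h c) (h d) z y"
    unfolding u2 s2 unfolding u_def s_def quartic_a_def h_mult h_power
    by (simp add: algebra_simps power2_eq_square power3_eq_cube power4_eq_xxxx)
  hence conic: "h d * u^2 + s * u + h b * s^2 = h (b^2 * c^3) * u"
    unfolding rel by (rule sum_eq_zeroD_char_two[OF char_top])
  have n: "u * ev t [:d, 1, b:] = h (b^2 * c^3)"
  proof -
    have "u * (u * ev t [:d, 1, b:]) = u * h (b^2 * c^3)"
      using conic unfolding s by (simp add: algebra_simps power2_eq_square)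
    thus ?thesis using \<open>u \<noteq> 0\<close> by simp
  qed
  define P where "P = h b * y^4 + h d * z^4 + h (a * b^2 * c^3 + a^2 * d)"
  define e where "e = h (b + b^2 * c^3)"
  have "(P + y^2 * u + e * z^2) + z * u = quartic_a (h a) (h b) (h c) (h d) z y"
    unfolding P_def e_def u_def quartic_a_def h_mult h_power h_add
    by (simp add: algebra_simps power2_eq_square power3_eq_cube power4_eq_xxxx)
  hence zu: "P + y^2 * u + e * z^2 = z * u"
    unfolding rel by (rule sum_eq_zeroD_char_two[OF char_top])
  have zL: "z \<in> L" if L: "subfield_over h L" and sq: "\<And>x. x^2 \<in> L" for L
  proof -
    note D = subfield_overD[OF L]
    have "(x^2)^2 \<in> L" for x using sq .
    hence four: "x^4 \<in> L" for x by (simp flip: power_mult)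
    have "u \<in> L" unfolding u_def by (intro D(1,4) sq)
    hence "P + y^2 * u + e * z^2 \<in> L" unfolding P_def e_def by (intro D(1,4,5) sq four)
    hence "z * u / u \<in> L" unfolding zu using \<open>u \<in> L\<close> by (rule D(9))
    thus ?thesis using \<open>u \<noteq> 0\<close> by simp
  qed
  have tL: "t \<in> L" if L: "subfield_over h L" and four: "\<And>x. x^4 \<in> L" for L
  proof -
    note D = subfield_overD[OF L]
    have u2L: "u^2 \<in> L" unfolding u2 by (intro D(1,4,10) four)
    have PL: "P \<in> L" unfolding P_def by (intro D(1,4,5) four)
    have "(z * u)^2 = P^2 + y^4 * u^2 + e^2 * z^4"
      unfolding zu[symmetric] square_add power_mult_distrib by (simp flip: power_mult)
    also have "\<dots> \<in> L" unfolding e_def by (intro D(1,4,5,10) PL four u2L)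
    finally have "(z * u)^2 / u^2 \<in> L" using u2L by (rule D(9))
    hence z2L: "z^2 \<in> L" using \<open>u \<noteq> 0\<close> by (simp add: power_mult_distrib)
    have uL: "u \<in> L" unfolding u_def by (intro D(1,4) z2L)
    have s2L: "s^2 \<in> L" unfolding s2 by (intro D(4) four z2L)
    have "h (b^2 * c^3) * u = s * u + (h d * u^2 + h b * s^2)"
      unfolding conic[symmetric] by (simp only: add_ac)
    hence "s * u = h (b^2 * c^3) * u + (h d * u^2 + h b * s^2)"
      by (rule sum_eqD_char_two[OF char_top])
    also have "\<dots> \<in> L" by (intro D(1,4,5) u2L s2L uL)
    finally have "s * u / u^2 \<in> L" using u2L by (rule D(9))
    thus ?thesis using \<open>u \<noteq> 0\<close> by (simp add: s power2_eq_square)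
  qed
  note E = subfield_over_ratfun[of t] and D = subfield_overD[OF subfield_over_ratfun[of t]]
  have "ev t [:d, 1, b:] \<noteq> 0" using n nz by auto
  hence "u = h (b^2 * c^3) / ev t [:d, 1, b:]" using n by (simp add: field_simps)
  also have "\<dots> \<in> ratfun t" by (intro D(1,9) ev_in_ratfun)
  finally have uE: "u \<in> ratfun t" .
  have z2E: "z^2 \<in> ratfun t" unfolding z2 by (intro D(1,4) uE)
  have tt: "transcendental_over h t"
    using algebraic_ratfun[OF _ z2E] transcendental_square[OF tr] by blast
  note F1 = subfield_over_quadratic_adjoin[OF E z2E]
  note F1D = subfield_overD[OF F1]
  have zF1: "z \<in> quadratic_adjoin (ratfun t) z" by (rule quadratic_adjoin_mem[OF E])
  have y2F1: "y^2 \<in> quadratic_adjoin (ratfun t) z"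
    unfolding y2 by (intro F1D(4,5) zF1 quadratic_adjoin_mem(2)[OF E] uE generator_in_ratfun)
  have all: "x \<in> quadratic_adjoin (quadratic_adjoin (ratfun t) z) y" for x
    by (rule adjoin_induct[OF gen subfield_over_quadratic_adjoin[OF F1 y2F1]])
      (intro quadratic_adjoin_mem[OF F1] zF1)+
  have sq: "x^2 \<in> quadratic_adjoin (ratfun t) z" for x
    by (rule quadratic_adjoin_square[OF F1 y2F1 all])
  have four: "x^4 \<in> ratfun t" for x
    using quadratic_adjoin_square[OF E z2E sq[of x]] by (simp flip: power_mult)
  show ?thesis 
    using that[OF tt z2 y2 n uE] all sq four power_fieldI[OF zL] power_fieldI[OF tL] by blast
qed

text \<open>
  The coordinates of \<open>z'\<close> and \<open>y'\<close> in the tower \<open>K(t) \<subseteq> K(t)(z) \<subseteq> F\<close>, scaled by the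
  denominators \<open>N\<close> and \<open>N'\<close> of \<open>u\<close> and \<open>u'\<close>, satisfy the equations of \<open>type_a_core\<close>. Once
  \<open>t' = t\<close> is known, \<open>u' = u\<close> and the uniqueness of square roots gives \<open>z' = z\<close>, \<open>y' = y\<close>.
\<close>

lemma type_a_generators_rigid:
  assumes gen: "adjoin h {z, y} = UNIV" and tr: "transcendental_over h z"
    and rel: "quartic_a (h a) (h b) (h c) (h d) z y = 0" and nz: "b \<noteq> 0" "c \<noteq> 0" and nsq: "a \<notin> squares"
    and gen': "adjoin h {z', y'} = UNIV" and tr': "transcendental_over h z'"
    and rel': "quartic_a (h a') (h b') (h c') (h d') z' y' = 0" and nz': "b' \<noteq> 0" "c' \<noteq> 0" and nsq': "a' \<notin> squares"
  shows "b * c^3 = b' * c'^3 \<and> (a = a' \<and> b = b' \<and> c = c' \<and> d = d' \<longrightarrow> z = z' \<and> y = y')"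
proof -
  obtain t u where t: "transcendental_over h t" and z2: "z^2 = h a + u" and y2: "y^2 = z + t * u"
    and n: "u * ev t [:d, 1, b:] = h (b^2 * c^3)" and uE: "u \<in> ratfun t"
    and all: "\<forall>x. x \<in> quadratic_adjoin (quadratic_adjoin (ratfun t) z) y"
    and sq: "\<forall>x. x^2 \<in> quadratic_adjoin (ratfun t) z" and four: "\<forall>x. x^4 \<in> ratfun t"
    and tP: "t \<in> power_field 4"
    using type_a_tower[OF gen tr rel nz] by metis
  obtain t' u' where z2': "z'^2 = h a' + u'" and y2': "y'^2 = z' + t' * u'"
    and n': "u' * ev t' [:d', 1, b':] = h (b'^2 * c'^3)" and four': "\<forall>x. x^4 \<in> ratfun t'"
    and zP': "z' \<in> power_field 2" and tP': "t' \<in> power_field 4"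
    using type_a_tower[OF gen' tr' rel' nz'] by metis
  note E = subfield_over_ratfun[of t] and D = subfield_overD[OF subfield_over_ratfun[of t]]
  define N where "N = [:d, 1, b:]"
  define Q where "Q = smult a (N^2) + smult (b^2 * c^3) N"
  \<comment> \<open>Multiplication by \<open>\<nu>\<close> turns \<open>z\<close> into a square root of the polynomial \<open>Q\<close>.\<close>
  define \<nu> where "\<nu> = ev t N"
  have n: "u * \<nu> = h (b^2 * c^3)" using n by (simp only: \<nu>_def N_def)
  have \<nu>: "\<nu> \<noteq> 0" using n nz by auto
  have \<nu>E: "\<nu> \<in> ratfun t" by (simp add: \<nu>_def)
  have z2E: "z^2 \<in> ratfun t" unfolding z2 by (intro D(1,4) uE)
  have evQ: "ev t Q = (\<nu> * z)^2"
    unfolding Q_def power_mult_distrib z2 ev_add ev_smult n[symmetric] ev_power \<nu>_def[symmetric]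
    by (simp add: algebra_simps power2_eq_square)
  have dQ: "pderiv Q = [:b^2 * c^3:]"
    by (simp add: Q_def N_def pderiv_add pderiv_smult pderiv_square_char_two[OF char] pderiv_pCons
        add_self_char_two[OF char])
  have e: "b^2 * c^3 \<noteq> 0" using nz by simp
  note polys = polynomial_from_square_sum[OF t _ _ dQ e]
  have znE: "z \<notin> ratfun t"
  proof
    assume "z \<in> ratfun t"
    hence "\<nu> * z \<in> ratfun t" using D(5) \<nu>E by blast
    moreover have "pderiv Q \<noteq> 0" using e dQ by simp
    ultimately show False using not_square_in_ratfun[OF t _ evQ[symmetric]] by blast
  qed
  define F1 where "F1 = quadratic_adjoin (ratfun t) z"
  have F1: "subfield_over h F1" unfolding F1_def by (rule subfield_over_quadratic_adjoin[OF E z2E])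
  note F1D = subfield_overD[OF F1]
  have EF1: "x \<in> F1" if "x \<in> ratfun t" for x unfolding F1_def using that by (rule quadratic_adjoin_mem(2)[OF E])
  have zF1: "z \<in> F1" unfolding F1_def by (rule quadratic_adjoin_mem[OF E])
  have t'E: "t' \<in> ratfun t" by (rule power_fieldD[OF tP' E]) (use four in blast)
  have tE': "t \<in> ratfun t'" by (rule power_fieldD[OF tP subfield_over_ratfun]) (use four' in blast)
  obtain \<alpha> \<beta> \<gamma> \<delta> where norm: "\<gamma> = 0 \<and> \<delta> = 1 \<or> \<gamma> = 1" and det: "\<alpha> * \<delta> \<noteq> \<beta> * \<gamma>"
    and M0: "ev t [:\<delta>, \<gamma>:] \<noteq> 0" and t'eq: "t' = ev t [:\<beta>, \<alpha>:] / ev t [:\<delta>, \<gamma>:]"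
    using generators_of_rational_function_field[OF t t'E tE'] by blast
  define L M where "L = [:\<beta>, \<alpha>:]" and "M = [:\<delta>, \<gamma>:]"
  define m where "m = ev t M"
  have m: "m \<noteq> 0" "t' * m = ev t L" using M0 t'eq by (simp_all add: m_def M_def L_def)
  define N' where "N' = smult b' (L^2) + L * M + smult d' (M^2)"
  define \<nu>' where "\<nu>' = ev t N'"
  have \<nu>'E: "\<nu>' \<in> ratfun t" by (simp add: \<nu>'_def)
  have n': "u' * \<nu>' = h (b'^2 * c'^3) * m^2"
    unfolding n'[symmetric] \<nu>'_def N'_def
    by (simp add: m(2)[symmetric] m_def[symmetric] algebra_simps power2_eq_square)
  have \<nu>': "\<nu>' \<noteq> 0" using n' nz' m by auto
  obtain A B where z': "z' = A + B * z" and A: "A \<in> ratfun t" and B: "B \<in> ratfun t"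
    using power_fieldD[OF zP' F1] sq unfolding F1_def by (metis quadratic_adjoinE)
  have "ev t (smult a' (N'^2) + smult (b'^2 * c'^3) (M^2 * N')) = \<nu>'^2 * z'^2"
    unfolding z2' by (simp add: n'[symmetric] m_def[symmetric] \<nu>'_def[symmetric] algebra_simps power2_eq_square)
      (use n' in \<open>simp add: algebra_simps power2_eq_square\<close>)
  also have "\<dots> = (A * \<nu>')^2 + (B * \<nu>' / \<nu>)^2 * ev t Q"
    unfolding evQ z' square_add using \<nu> by (simp add: field_simps power_mult_distrib)
  finally have eq1: "ev t (smult a' (N'^2) + smult (b'^2 * c'^3) (M^2 * N')) =
    (A * \<nu>')^2 + (B * \<nu>' / \<nu>)^2 * ev t Q" .
  obtain S k where S: "A * \<nu>' = ev t S" and k: "B * \<nu>' / \<nu> = ev t k"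
    and eq1: "smult a' (N'^2) + smult (b'^2 * c'^3) (M^2 * N') = S^2 + k^2 * Q"
    using polys[OF _ _ eq1] D(5,9) A B \<nu>E \<nu>'E by metis
  have "\<gamma> \<noteq> 1"
  proof
    assume "\<gamma> = 1"
    with det have "\<alpha> * \<delta> \<noteq> \<beta>" by simp
    from type_a_affine[OF char nsq' nz'(1) nz this] eq1 show False
      unfolding N'_def L_def M_def Q_def N_def \<open>\<gamma> = 1\<close> by blast
  qed
  with norm have \<gamma>: "\<gamma> = 0" "\<delta> = 1" by auto
  with det have \<alpha>: "\<alpha> \<noteq> 0" by simp
  have M: "M = 1" by (simp add: M_def \<gamma> one_pCons)
  have m1: "m = 1" by (simp add: m_def M)
  have tL: "t' = ev t L" using m by (simp add: m1)
  have n': "u' * \<nu>' = h (b'^2 * c'^3)" using n' by (simp add: m1)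
  have N'eq: "N' = smult b' (L^2) + L + [:d':]" by (simp add: N'_def M)
  obtain C G where y': "y' = C + G * y" and C: "C \<in> F1" and G: "G \<in> F1"
    using all[rule_format, of y'] unfolding F1_def by (rule quadratic_adjoinE)
  obtain c0 c1 where Ceq: "C = c0 + c1 * z" and c0: "c0 \<in> ratfun t" and c1: "c1 \<in> ratfun t"
    using C unfolding F1_def by (rule quadratic_adjoinE)
  obtain g0 g1 where Geq: "G = g0 + g1 * z" and g0: "g0 \<in> ratfun t" and g1: "g1 \<in> ratfun t"
    using G unfolding F1_def by (rule quadratic_adjoinE)
  have C2: "C^2 \<in> ratfun t" and G2: "G^2 \<in> ratfun t"
    using quadratic_adjoin_square[OF E z2E] C G unfolding F1_def by blast+
  have u'E: "u' \<in> ratfun t"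
  proof -
    have "u' = h (b'^2 * c'^3) / \<nu>'" using n' \<nu>' by (simp add: field_simps)
    thus ?thesis using D(1,9) \<nu>'E by metis
  qed
  have "(A + t' * u') + B * z = (C^2 + G^2 * t * u) + G^2 * z"
  proof -
    have "(A + t' * u') + B * z = y'^2" unfolding y2' z' by (simp add: algebra_simps)
    also have "\<dots> = C^2 + G^2 * (z + t * u)" unfolding y' square_add power_mult_distrib y2 ..
    finally show ?thesis by (simp add: algebra_simps)
  qed
  from quadratic_adjoin_unique[OF E znE _ B _ G2 this]
  have cmp: "A + t' * u' = C^2 + G^2 * t * u" "B = G^2"
    using A C2 G2 u'E uE t'E generator_in_ratfun[of t] D(4,5) by (meson)+
  have "ev t (k * N * N') = \<nu>'^2 * G^2"
    unfolding cmp(2)[symmetric] ev_mult k[symmetric] \<nu>_def[symmetric] \<nu>'_def[symmetric]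
    using \<nu> by (simp add: power2_eq_square)
  also have "\<dots> = (g0 * \<nu>')^2 + (g1 * \<nu>' / \<nu>)^2 * ev t Q"
    unfolding evQ Geq square_add using \<nu> by (simp add: field_simps power_mult_distrib)
  finally have eq2: "ev t (k * N * N') = (g0 * \<nu>')^2 + (g1 * \<nu>' / \<nu>)^2 * ev t Q" .
  obtain k0 k1 where eq2: "k * N * N' = k0^2 + k1^2 * Q"
    using polys[OF _ _ eq2] D(5,9) g0 g1 \<nu>E \<nu>'E by metis
  have "ev t (N' * (S + smult (b'^2 * c'^3) L + smult (b^2 * c^3) (k * [:0, 1:]))) =
      \<nu>' * (ev t S + h (b'^2 * c'^3) * t' + h (b^2 * c^3) * ev t k * t)"
    unfolding tL by (simp add: \<nu>'_def algebra_simps)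
  also have "\<dots> = \<nu>'^2 * (A + t' * u' + B * (t * u))"
    unfolding S[symmetric] k[symmetric] n[symmetric] n'[symmetric] using \<nu>
    by (simp add: field_simps power2_eq_square)
  also have "A + t' * u' + B * (t * u) = C^2"
    unfolding cmp(1) cmp(2)[symmetric] by (simp add: add_self_char_two[OF char_top] mult.assoc add.assoc)
  also have "\<nu>'^2 * C^2 = (c0 * \<nu>')^2 + (c1 * \<nu>' / \<nu>)^2 * ev t Q"
    unfolding evQ Ceq square_add using \<nu> by (simp add: field_simps power_mult_distrib)
  finally have eq3: "ev t (N' * (S + smult (b'^2 * c'^3) L + smult (b^2 * c^3) (k * [:0, 1:]))) =
    (c0 * \<nu>')^2 + (c1 * \<nu>' / \<nu>)^2 * ev t Q" .
  obtain l0 l1 where eq3: "N' * (S + smult (b'^2 * c'^3) L + smult (b^2 * c^3) (k * [:0, 1:])) = l0^2 + l1^2 * Q"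
    using polys[OF _ _ eq3] D(5,9) c0 c1 \<nu>E \<nu>'E by metis
  have core: "b * c^3 = b' * c'^3 \<and> (a = a' \<and> b = b' \<and> c = c' \<and> d = d' \<longrightarrow> \<alpha> = 1 \<and> \<beta> = 0)"
    using type_a_core[OF char nsq nz'(1) nz nz'(2) \<alpha>] eq1 eq2 eq3
    unfolding N'eq L_def N_def Q_def M by (simp only: one_power2 mult_1_left) blast
  show ?thesis
  proof (intro conjI impI)
    assume same: "a = a' \<and> b = b' \<and> c = c' \<and> d = d'"
    with core have "t' = t" by (simp add: tL L_def)
    have "N' = N" using core same by (simp add: N'eq L_def N_def power2_eq_square)
    hence "u' * \<nu> = u * \<nu>" using n n' same by (simp add: \<nu>_def \<nu>'_def)
    hence u': "u' = u" using \<nu> by simp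
    hence "z^2 = z'^2" using same by (simp add: z2 z2')
    thus z': "z = z'" using square_eq_iff_char_two[OF char_top] by blast
    have "y^2 = y'^2" by (simp add: y2 y2' z' u' \<open>t' = t\<close>)
    thus "y = y'" using square_eq_iff_char_two[OF char_top] by blast
  qed (use core in blast)
qed

end

section \<open>Type (b)\<close>

text \<open>
  The equation says that \<open>f(t')\<close>, for \<open>t' = L / M\<close>, is a square in \<open>K(t)(\<surd>f)\<close>. Differentiation
  shows that \<open>(\<alpha> \<delta> + \<beta> \<gamma>) (L^2 + b M^2) (t^2 + b)\<close> is a square. As \<open>t^2 + b\<close> is the square of
  \<open>t + \<surd>b\<close> and \<open>\<surd>b\<close> is not in \<open>K\<close>, this forces \<open>L + \<surd>b M\<close> to be proportional to \<open>t + \<surd>b\<close>: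
  the fractional linear map fixes \<open>\<surd>b\<close>. The proof expresses this in terms of \<open>b\<close> alone.
\<close>

lemma type_b_core:
  fixes a b c \<alpha> \<beta> \<gamma> \<delta> :: "'k::field" and r g q :: "'k poly"
  assumes char: "CHAR('k) = 2" and nsq: "b \<notin> squares"
  defines "f \<equiv> [:c, b, 0, 1, a:]"
  defines "L \<equiv> [:\<beta>, \<alpha>:]" and "M \<equiv> [:\<delta>, \<gamma>:]"
  assumes det: "\<alpha> * \<delta> \<noteq> \<beta> * \<gamma>" and q: "q \<noteq> 0"
    and eq: "(smult a (L^4) + L^3 * M + smult b (L * M^3) + smult c (M^4)) * q^2 = g^2 + r^2 * f"
  shows "\<alpha> = \<delta> \<and> \<beta> = b * \<gamma> \<and> r = smult (\<alpha>^2 + b * \<gamma>^2) q"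
proof -
  note [simp] = pderiv_add pderiv_smult pderiv_mult pderiv_square_char_two[OF char] pderiv_pCons
    add_self_char_two[OF char] 
  note two [simp] = char_two_eq_zero[OF char]
  define D where "D = \<alpha> * \<delta> + \<beta> * \<gamma>"
  have pow: "p^3 = p * p^2" "p^4 = (p^2)^2" for p :: "'k poly"
    by (simp_all add: power2_eq_square power3_eq_cube power4_eq_xxxx mult_ac)
  have d4 [simp]: "pderiv (p^4) = 0" for p :: "'k poly"
    by (simp only: pow pderiv_square_char_two[OF char])
  have df: "pderiv f = [:b, 0, 1:]"
  proof -
    have "(4::'k) = 2 * 2" by (simp del: two)
    also have "\<dots> = 0" by (simp only: two mult_zero_left)
    finally have "(4::'k) = 0" .
    have "(3::'k) = 2 + 1" by (simp del: two)
    also have "\<dots> = 1" by (simp only: two add_0)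
    finally have "(3::'k) = 1" .
    show ?thesis
      by (simp add: f_def \<open>(3::'k) = 1\<close> \<open>(4::'k) = 0\<close>)
  qed
  define X where "X = \<alpha>^2 + b * \<gamma>^2"
  have "pderiv (smult a (L^4) + L^3 * M + smult b (L * M^3) + smult c (M^4)) =
      smult D (L^2 + smult b (M^2))"
  proof -
    have "smult a (L^4) + L^3 * M + smult b (L * M^3) + smult c (M^4) =
        smult a ((L^2)^2) + L^2 * (L * M) + smult b (M^2 * (L * M)) + smult c ((M^2)^2)"
      by (simp only: pow) (simp only: mult_ac)
    also have "pderiv \<dots> = L^2 * pderiv (L * M) + smult b (M^2 * pderiv (L * M))"
      by (simp del: pderiv_mult add: pderiv_mult[of "L^2"] pderiv_mult[of "M^2"])
    also have "pderiv (L * M) = [:D:]"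
      by (simp add: L_def M_def D_def mult_ac)
    finally show ?thesis by (simp add: smult_add_right mult_ac)
  qed
  hence "pderiv ((smult a (L^4) + L^3 * M + smult b (L * M^3) + smult c (M^4)) * q^2) =
      smult D (L^2 + smult b (M^2)) * q^2"
    by (simp only: pderiv_mult pderiv_square_char_two[OF char] mult_zero_right add_0) (rule mult.commute)
  hence *: "smult D (L^2 + smult b (M^2)) * q^2 = r^2 * [:b, 0, 1:]"
    unfolding eq by (simp add: df)
  have "smult D (L^2 + smult b (M^2)) * [:b, 0, 1:] * q^2 =
      (smult D (L^2 + smult b (M^2)) * q^2) * [:b, 0, 1:]"
    by (simp only: mult_ac)
  also have "\<dots> = (r * [:b, 0, 1:])^2"
    unfolding * by (simp only: power2_eq_square mult_ac)
  finally have "smult D (L^2 + smult b (M^2)) * [:b, 0, 1:] * q^2 = (r * [:b, 0, 1:])^2" .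
  from square_quotient_imp_square[OF char this q] obtain k where
    k: "smult D (L^2 + smult b (M^2)) * [:b, 0, 1:] = k^2" and rk: "r * [:b, 0, 1:] = k * q" by blast
  have "k^2 = [:D * (\<beta>^2 + b * \<delta>^2) * b, 0, D * (\<beta>^2 + b * \<delta>^2) + D * X * b, 0, D * X, 0, 0:]"
    unfolding k[symmetric]
    by (simp add: L_def M_def X_def square_pCons_char_two[OF char] algebra_simps)
  then obtain k0 k1 k2 k3 where k: "k = [:k0, k1, k2, k3:]" 
    and k0: "D * (\<beta>^2 + b * \<delta>^2) * b = k0^2"
    and k1: "D * (\<beta>^2 + b * \<delta>^2) + D * X * b = k1^2"
    and k2: "D * X = k2^2" and k3: "0 = k3^2"
    using square_eq_coeffs[OF char] by blast
  have "D \<noteq> 0" using det sum_eq_zeroD_char_two[OF char, of "\<alpha> * \<delta>" "\<beta> * \<gamma>"] D_def by auto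
  \<comment> \<open>The square coefficients satisfy \<open>b k\<^sub>1^2 = k\<^sub>0^2 + b^2 k\<^sub>2^2\<close>, so \<open>k\<^sub>1 = 0\<close> as \<open>b\<close> is not a square.\<close>
  have "b * k1^2 = (k0 + b * k2)^2"
    unfolding square_add_char_two[OF char] using k0 k1 k2 by algebra
  from nonsquare_mult_square[OF nsq this] have "k1 = 0" "k0 + b * k2 = 0" by blast+
  hence "k0 = b * k2" using sum_eq_zeroD_char_two[OF char] by blast
  have "D * ((\<beta>^2 + b * \<delta>^2) + X * b) = 0" using k1 \<open>k1 = 0\<close> by (simp add: algebra_simps)
  hence "(\<beta>^2 + b * \<delta>^2) + X * b = 0" using \<open>D \<noteq> 0\<close> by simp
  hence "(\<beta> + b * \<gamma>)^2 + b * (\<alpha> + \<delta>)^2 = 0"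
    unfolding square_add_char_two[OF char] X_def by (simp add: algebra_simps power2_eq_square)
  hence "b * (\<alpha> + \<delta>)^2 = (\<beta> + b * \<gamma>)^2"
    by (rule sum_eq_zeroD_char_two[OF char, symmetric])
  from nonsquare_mult_square[OF nsq this] have "\<alpha> + \<delta> = 0" "\<beta> + b * \<gamma> = 0" by blast+
  hence "\<alpha> = \<delta>" "\<beta> = b * \<gamma>" using sum_eq_zeroD_char_two[OF char] by blast+
  hence "D = X" by (simp add: D_def X_def power2_eq_square mult_ac)
  hence "k2^2 = X^2" using k2 by (simp add: power2_eq_square)
  hence "k2 = X" using square_eq_iff_char_two[OF char] by blast
  have "k = smult X [:b, 0, 1:]"
    using k \<open>k0 = b * k2\<close> \<open>k1 = 0\<close> \<open>k2 = X\<close> k3 by (simp add: mult_ac)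
  hence "r * [:b, 0, 1:] = smult X q * [:b, 0, 1:]" using rk by (simp add: mult.commute)
  hence "r = smult X q" by (simp only: mult_cancel_right) simp
  with \<open>\<alpha> = \<delta>\<close> \<open>\<beta> = b * \<gamma>\<close> show ?thesis unfolding X_def by blast
qed

context char_two_extension
begin

text \<open>
  Modulo \<open>K(F^4)\<close> the quartic reads \<open>z (z^2 + b) = 0\<close>. Squaring it yields \<open>z^2 \<in> K(F^4)\<close>, and
  then \<open>z \<in> K(F^4)\<close>.
\<close>

lemma type_b_tower:
  assumes gen: "adjoin h {z, y} = UNIV" and tr: "transcendental_over h z"
    and rel: "quartic_b (h a) (h b) (h c) z y = 0"
  shows "y^4 = ev z [:c, b, 0, 1, a:]"
    "x \<in> quadratic_adjoin (quadratic_adjoin (ratfun z) (y^2)) y"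
    "x^2 \<in> quadratic_adjoin (ratfun z) (y^2)" "x^4 \<in> ratfun z"
    "z \<in> power_field 4"
proof -
  have "y^4 + ev z [:c, b, 0, 1, a:] = quartic_b (h a) (h b) (h c) z y"
    by (simp add: quartic_b_def algebra_simps power3_eq_cube power4_eq_xxxx)
  thus y4: "y^4 = ev z [:c, b, 0, 1, a:]"
    unfolding rel by (rule sum_eq_zeroD_char_two[OF char_top])
  note E = subfield_over_ratfun[of z]
  have "(y^2)^2 = y^4" by (simp flip: power_mult)
  hence wE: "(y^2)^2 \<in> ratfun z" by (simp only: y4 ev_in_ratfun)
  note F1 = subfield_over_quadratic_adjoin[OF E wE]
  have wF1: "y^2 \<in> quadratic_adjoin (ratfun z) (y^2)" by (rule quadratic_adjoin_mem[OF E])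
  show all: "x \<in> quadratic_adjoin (quadratic_adjoin (ratfun z) (y^2)) y" for x
    by (rule adjoin_induct[OF gen subfield_over_quadratic_adjoin[OF F1 wF1]])
      (intro quadratic_adjoin_mem[OF F1] quadratic_adjoin_mem[OF E] generator_in_ratfun)+
  show sq: "x^2 \<in> quadratic_adjoin (ratfun z) (y^2)" for x
    by (rule quadratic_adjoin_square[OF F1 wF1 all])
  show "x^4 \<in> ratfun z"
    using quadratic_adjoin_square[OF E wE sq[of x]] by (simp flip: power_mult)
  have "z \<in> L" if L: "subfield_over h L" and four: "\<And>x. x^4 \<in> L" for L
  proof -
    note D = subfield_overD[OF L]
    define s where "s = z * (z^2 + h b)"
    have nz: "z^2 + h b \<noteq> 0"
    proof -
      have "z^2 + h b = ev z [:b, 0, 1:]" by (simp add: power2_eq_square)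
      thus ?thesis using tr unfolding transcendental_iff by (metis pCons_eq_0_iff one_neq_zero)
    qed
    have "y^4 + h a * z^4 + h c + s = quartic_b (h a) (h b) (h c) z y"
      by (simp add: s_def quartic_b_def algebra_simps power2_eq_square power3_eq_cube)
    hence s: "y^4 + h a * z^4 + h c = s"
      unfolding rel by (rule sum_eq_zeroD_char_two[OF char_top])
    have sL: "s \<in> L" unfolding s[symmetric] by (intro D(1,4,5) four)
    have q: "(z^2 + h b)^2 = z^4 + (h b)^2" by (simp add: square_add flip: power_mult)
    have qL: "(z^2 + h b)^2 \<in> L" unfolding q by (intro D(1,4,10) four)
    have "s^2 / (z^2 + h b)^2 \<in> L" by (intro D(9,10) sL qL)
    hence "z^2 \<in> L" using nz by (simp add: s_def power_mult_distrib)
    hence "s / (z^2 + h b) \<in> L" by (intro D(1,4,9) sL)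
    thus ?thesis using nz by (simp add: s_def)
  qed
  thus "z \<in> power_field 4" by (rule power_fieldI)
qed

text \<open>
  By \<open>type_b_core\<close> the map \<open>z \<mapsto> z'\<close> is \<open>(\<alpha> z + b \<gamma>) / (\<gamma> z + \<alpha>)\<close>, and
  \<open>y'^2 = A + B y^2\<close> where \<open>B\<close> is \<open>\<alpha>^2 + b \<gamma>^2\<close> up to a square. As \<open>y'\<close> lies in
  \<open>K(z, y^2)(y)\<close>, this \<open>B\<close> is a square in \<open>K(z, y^2)\<close>, and a second differentiation shows that
  \<open>\<alpha>^2 + b \<gamma>^2\<close> is a square in \<open>K\<close>. Hence \<open>\<gamma> = 0\<close>.
\<close>

lemma type_b_generators_unique:
  assumes gen: "adjoin h {z, y} = UNIV" and tr: "transcendental_over h z"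
    and rel: "quartic_b (h a) (h b) (h c) z y = 0" and nsq: "b \<notin> squares"
    and gen': "adjoin h {z', y'} = UNIV" and tr': "transcendental_over h z'"
    and rel': "quartic_b (h a) (h b) (h c) z' y' = 0"
  shows "z = z' \<and> y = y'"
proof -
  note T = type_b_tower[OF gen tr rel] and T' = type_b_tower[OF gen' tr' rel']
  note E = subfield_over_ratfun[of z] and D = subfield_overD[OF subfield_over_ratfun[of z]]
  define f where "f = [:c, b, 0, 1, a:]"
  define w where "w = y^2"
  define w' where "w' = y'^2"
  have w2: "w^2 = ev z f" using T(1) by (simp add: w_def f_def flip: power_mult)
  have w2': "w'^2 = ev z' f" using T'(1) by (simp add: w'_def f_def flip: power_mult)
  have df: "pderiv f \<noteq> 0"
  proof -
    have "coeff (pderiv f) 2 = 3" by (simp add: f_def coeff_pderiv numeral_2_eq_2)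
    also have "(3::'k) = 2 + 1" by simp
    finally show ?thesis using char_two_eq_zero[OF char] by auto
  qed
  have wnE: "w \<notin> ratfun z" by (rule not_square_in_ratfun[OF tr df w2])
  have wE: "w^2 \<in> ratfun z" by (simp add: w2)
  define F1 where "F1 = quadratic_adjoin (ratfun z) w"
  have zE': "z' \<in> ratfun z" by (rule power_fieldD[OF T'(5) E T(4)])
  have zE: "z \<in> ratfun z'" by (rule power_fieldD[OF T(5) subfield_over_ratfun T'(4)])
  obtain \<alpha> \<beta> \<gamma> \<delta> where norm: "\<gamma> = 0 \<and> \<delta> = 1 \<or> \<gamma> = 1" and det: "\<alpha> * \<delta> \<noteq> \<beta> * \<gamma>"
    and M0: "ev z [:\<delta>, \<gamma>:] \<noteq> 0" and z'eq: "z' = ev z [:\<beta>, \<alpha>:] / ev z [:\<delta>, \<gamma>:]"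
    using generators_of_rational_function_field[OF tr zE' zE] by blast
  define L M where "L = [:\<beta>, \<alpha>:]" and "M = [:\<delta>, \<gamma>:]"
  define m where "m = ev z M"
  have m: "m \<noteq> 0" "ev z L = z' * m" using M0 z'eq by (simp_all add: m_def M_def L_def)
  have mE: "m \<in> ratfun z" by (simp add: m_def)
  obtain A B where w': "w' = A + B * w" and A: "A \<in> ratfun z" and B: "B \<in> ratfun z"
    using T(3)[of y'] unfolding w_def w'_def by (rule quadratic_adjoinE)
  define X where "X = smult a (L^4) + L^3 * M + smult b (L * M^3) + smult c (M^4)"
  have "ev z X = m^4 * w'^2"
    unfolding w2' X_def f_def
    by (simp add: m m_def[symmetric] algebra_simps power2_eq_square power3_eq_cube power4_eq_xxxx)
  also have "\<dots> = (A * m^2)^2 + (B * m^2)^2 * ev z f"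
    unfolding w' square_add w2[symmetric] by (simp add: algebra_simps power2_eq_square power4_eq_xxxx)
  finally have evX: "ev z X = (A * m^2)^2 + (B * m^2)^2 * ev z f" .
  have "A * m^2 \<in> ratfun z" "B * m^2 \<in> ratfun z" by (intro D(5,10) A B mE)+
  then obtain g r q where g: "A * m^2 = ev z g / ev z q" and r: "B * m^2 = ev z r / ev z q"
    and q: "ev z q \<noteq> 0" using common_denominator by blast
  have "ev z (X * q^2) = ev z (g^2 + r^2 * f)"
    using q by (simp add: evX g r power_divide field_simps)
  hence eq: "X * q^2 = g^2 + r^2 * f" using ev_eq_iff[OF tr] by blast
  have "q \<noteq> 0" using q by auto
  from type_b_core[OF char nsq det this] eq have B1: "\<alpha> = \<delta>" "\<beta> = b * \<gamma>" "r = smult (\<alpha>^2 + b * \<gamma>^2) q"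
    unfolding X_def L_def M_def f_def by blast+
  have Bm: "B * m^2 = h (\<alpha>^2 + b * \<gamma>^2)" unfolding r B1(3) using q by simp
  obtain C G where y': "y' = C + G * y" and C: "C \<in> F1" and G: "G \<in> F1"
    using T(2)[of y'] unfolding F1_def w_def by (rule quadratic_adjoinE)
  obtain g0 g1 where Geq: "G = g0 + g1 * w" and g0: "g0 \<in> ratfun z" and g1: "g1 \<in> ratfun z"
    using G unfolding F1_def by (rule quadratic_adjoinE)
  have C2: "C^2 \<in> ratfun z" and G2: "G^2 \<in> ratfun z"
    using quadratic_adjoin_square[OF E wE] C G unfolding F1_def by blast+
  have "A + B * w = C^2 + G^2 * w"
    unfolding w'[symmetric] unfolding w'_def w_def y' square_add power_mult_distrib ..
  from quadratic_adjoin_unique[OF E wnE A B C2 G2 this] have "B = G^2" by blast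
  hence "ev z [:\<alpha>^2 + b * \<gamma>^2:] = (g0 * m)^2 + (g1 * m)^2 * ev z f"
    using Bm \<open>B = G^2\<close> unfolding Geq square_add w2[symmetric]
    by (simp add: algebra_simps power_mult_distrib)
  moreover have "g0 * m \<in> ratfun z" "g1 * m \<in> ratfun z" by (intro D(5) g0 g1 mE)+
  then obtain i0 i1 p where i: "g0 * m = ev z i0 / ev z p" "g1 * m = ev z i1 / ev z p"
    and p: "ev z p \<noteq> 0" using common_denominator by blast
  ultimately have "ev z ([:\<alpha>^2 + b * \<gamma>^2:] * p^2) = ev z (i0^2 + i1^2 * f)"
    by (simp add: power_divide field_simps)
  hence eq: "[:\<alpha>^2 + b * \<gamma>^2:] * p^2 = i0^2 + i1^2 * f" using ev_eq_iff[OF tr] by blast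
  have "p \<noteq> 0" using p by auto
  have "i1^2 * pderiv f = 0"
    using arg_cong[OF eq, of pderiv]
    by (simp add: pderiv_add pderiv_mult pderiv_smult pderiv_square_char_two[OF char])
  hence "i1 = 0" using df by simp
  with eq have "[:\<alpha>^2 + b * \<gamma>^2:] * p^2 = i0^2" by simp
  from square_quotient_imp_square[OF char this \<open>p \<noteq> 0\<close>] obtain k where
    "[:\<alpha>^2 + b * \<gamma>^2:] = k^2" by blast
  hence "smult 1 (k^2) = [:\<alpha>^2 + b * \<gamma>^2:]" by simp
  from smult_square_eq_const[OF char this] obtain x where "\<alpha>^2 + b * \<gamma>^2 = x^2" by auto
  hence "b * \<gamma>^2 = (x + \<alpha>)^2"
    using sum_eqD_char_two[OF char, of "x^2" "b * \<gamma>^2" "\<alpha>^2"]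
    by (simp add: square_add_char_two[OF char] add.commute)
  from nonsquare_mult_square[OF nsq this] have "\<gamma> = 0" by blast
  hence "\<alpha> = 1" "\<beta> = 0" using norm B1 by auto
  hence z': "z' = z" using \<open>\<gamma> = 0\<close> norm by (simp add: z'eq)
  hence "w^2 = w'^2" by (simp add: w2 w2')
  hence "w = w'" using square_eq_iff_char_two[OF char_top] by blast
  hence "y = y'" unfolding w_def w'_def using square_eq_iff_char_two[OF char_top] by blast
  with z' show ?thesis by simp
qed

end

section \<open>Type (c)\<close>

text \<open>
  The three equations express \<open>u' \<in> K(t)(u)\<close> and \<open>z' \<in> K(t)(u, z)\<close>, for \<open>t' = L / M\<close> with a
  pole at \<open>t = \<delta>\<close>. There \<open>k\<close> and \<open>S\<close> vanish, and the third equation writes \<open>b'\<close>, up to a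
  nonzero square, as \<open>l\<^sub>0^2 + l\<^sub>1^2 a b^2 N\<close>. If \<open>k\<^sub>1\<close> does not vanish at \<open>\<delta>\<close>, the second equation
  makes the value of \<open>a b^2 N\<close> a square; if \<open>k\<^sub>1\<close> vanishes, the derivative of the second
  equation makes it zero. Either way \<open>b'\<close> would be a square.
\<close>

lemma type_c_affine:
  fixes S k k0 k1 l0 l1 :: "'k::field poly" and a b c d a' b' c' d' \<alpha> \<beta> \<delta> :: 'k
  assumes char: "CHAR('k) = 2" and nsq: "a \<notin> squares" "b' \<notin> squares" and nz: "a' \<noteq> 0" "b' \<noteq> 0" "b \<noteq> 0" "d \<noteq> 0" "d' \<noteq> 0"
  defines "N \<equiv> [:c + a, d, 1:]"
  defines "L \<equiv> [:\<beta>, \<alpha>:]" and "M \<equiv> [:\<delta>, 1:]"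
  defines "N' \<equiv> L^2 + smult d' (L * M) + smult (c' + a') (M^2)"
  assumes det: "\<alpha> * \<delta> \<noteq> \<beta>"
    and eq1: "smult (a' * b'^2) (M^2 * N') = S^2 + k^2 * smult (a * b^2) N"
    and eq2: "k * N * N' = k0^2 + k1^2 * smult (a * b^2) N"
    and eq3: "N' * (S + smult b' N') + smult b (k * N * N') = l0^2 + l1^2 * smult (a * b^2) N"
  shows False
proof -
  note [simp] = pderiv_add pderiv_smult pderiv_mult pderiv_square_char_two[OF char] pderiv_pCons
    add_self_char_two[OF char] 
  note two [simp] = char_two_eq_zero[OF char]
  have "a \<noteq> 0" using nsq by (metis rangeI zero_power2)
  define l where "l = \<beta> + \<alpha> * \<delta>"
  have "l \<noteq> 0" using det sum_eq_zeroD_char_two[OF char] l_def by metis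
  have M: "poly M \<delta> = 0" by (simp add: M_def)
  have N': "poly N' \<delta> = l^2" by (simp add: N'_def M) (simp add: L_def l_def mult_ac)
  have dN': "pderiv N' = [:d' * l:]"
    by (simp add: N'_def) (simp add: L_def M_def l_def algebra_simps)
  have dN: "pderiv N = [:d:]" by (simp add: N_def)
  have "smult (a * b^2 * d) (k^2) = smult (a' * b'^2 * (d' * l)) (M^2)"
    using arg_cong[OF eq1, of pderiv] by (simp add: dN dN' mult_ac)
  also have "\<dots> = [:a' * b'^2 * (d' * l) * \<delta>^2, 0, a' * b'^2 * (d' * l):]"
    by (simp add: M_def square_pCons_char_two[OF char])
  finally obtain x0 x1 where k: "k = [:x0, x1:]" and x0: "a' * b'^2 * (d' * l) * \<delta>^2 = a * b^2 * d * x0^2"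
    and x1: "a' * b'^2 * (d' * l) = a * b^2 * d * x1^2"
    using smult_square_eq_linear[OF char, of "a * b^2 * d" k] nz \<open>a \<noteq> 0\<close> by auto
  have "x1 \<noteq> 0" using x1 nz \<open>l \<noteq> 0\<close> by auto
  have "a * b^2 * d * (x0^2) = a * b^2 * d * ((\<delta> * x1)^2)" using x0 x1 by algebra
  hence "x0^2 = (\<delta> * x1)^2" using nz \<open>a \<noteq> 0\<close> by simp
  hence "x0 = \<delta> * x1" using square_eq_iff_char_two[OF char] by blast
  hence kd: "poly k \<delta> = 0" by (simp add: k)
  have "(poly S \<delta>)^2 = 0"
    using arg_cong[OF eq1, of "\<lambda>p. poly p \<delta>"] by (simp add: kd M)
  hence Sd: "poly S \<delta> = 0" by simp
  have e2: "(poly k0 \<delta>)^2 + (poly k1 \<delta>)^2 * (a * b^2 * poly N \<delta>) = 0"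
    using arg_cong[OF eq2, of "\<lambda>p. poly p \<delta>"] by (simp add: kd mult_ac)
  have e3: "b' * (l^2)^2 = (poly l0 \<delta>)^2 + (poly l1 \<delta>)^2 * (a * b^2 * poly N \<delta>)"
    using arg_cong[OF eq3, of "\<lambda>p. poly p \<delta>"] by (simp add: kd Sd N' power2_eq_square mult_ac)
  have square: False if "b' * (l^2)^2 = x^2" for x
    using nonsquare_mult_square[OF nsq(2) that] \<open>l \<noteq> 0\<close> by simp
  have "poly k1 \<delta> = 0"
  proof (rule ccontr)
    assume nz1: "poly k1 \<delta> \<noteq> 0"
    have "(poly k0 \<delta>)^2 = (poly k1 \<delta>)^2 * (a * b^2 * poly N \<delta>)"
      using e2 by (rule sum_eq_zeroD_char_two[OF char])
    hence "a * b^2 * poly N \<delta> = (poly k0 \<delta> / poly k1 \<delta>)^2"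
      using nz1 by (simp add: field_simps)
    hence "b' * (l^2)^2 = (poly l0 \<delta> + poly l1 \<delta> * (poly k0 \<delta> / poly k1 \<delta>))^2"
      unfolding square_add_char_two[OF char] power_mult_distrib using e3 by simp
    thus False by (rule square)
  qed
  have "x1 * (poly N \<delta> * l^2) = 0"
    using arg_cong[OF eq2, of "\<lambda>p. poly (pderiv p) \<delta>"] \<open>poly k1 \<delta> = 0\<close>
    by (auto simp: kd N') (auto simp: k)
  hence "poly N \<delta> = 0" using \<open>x1 \<noteq> 0\<close> \<open>l \<noteq> 0\<close> by simp
  with e3 have "b' * (l^2)^2 = (poly l0 \<delta>)^2" by simp
  thus False by (rule square)
qed

text \<open>
  The affine case \<open>t' = \<alpha> t + \<beta>\<close>. Membership of \<open>u'\<close> in \<open>K(t)(u)\<close> (first equation), of \<open>z'\<close> in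
  \<open>K(t)(u, z)\<close> (next two) and of \<open>y'\<close> in \<open>K(t)(u, z, y)\<close> (last four) is expressed by squaring
  and comparing coordinates. With \<open>N\<close> and \<open>N'\<close> the denominators of \<open>u^2\<close> and \<open>u'^2\<close>, the
  unknown polynomials are numerators of coordinates: \<open>u' = (S + k N u) / N'\<close> and
  \<open>z' = (l\<^sub>0 + l\<^sub>1 N u) / N' + ((k\<^sub>0 + k\<^sub>1 N u) / N') z\<close>.
  The decisive constant is \<open>k = e\<close>. Once \<open>k\<^sub>1\<close> is seen to be constant, \<open>d' = d \<alpha>\<close> and
  \<open>e^2 \<iota> = \<iota>'\<close> follow; the leading coefficient in the sixth equation then yields \<open>e = 1\<close>.
\<close>

lemma type_c_core:
  fixes S k k0 k1 l0 l1 :: "'k::field poly" and a b c d a' b' c' d' \<alpha> \<beta> :: 'k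
  assumes char: "CHAR('k) = 2" and nsq: "a \<notin> squares" "b \<notin> squares"
    and nz: "d \<noteq> 0" "d' \<noteq> 0" "\<alpha> \<noteq> 0" "a' \<noteq> 0" "b' \<noteq> 0"
  defines "N \<equiv> [:c + a, d, 1:]"
  defines "L \<equiv> [:\<beta>, \<alpha>:]"
  defines "N' \<equiv> L^2 + smult d' L + [:c' + a':]"
  defines "Y \<equiv> smult (a * b^2) N"
  defines "X \<equiv> l1 * N + L * k * N + k0 * [:0, 1:]"
  assumes eq1: "smult (a' * b'^2) N' = S^2 + k^2 * Y"
    and eq2: "k * N * N' = k0^2 + k1^2 * Y"
    and eq3: "N' * (S + smult b' N') + smult b (k * N * N') = l0^2 + l1^2 * Y"
    and eq4: "k1 * N * N' = m0^2 + m1^2 * Y"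
    and eq5: "k0 * N' + smult b (k1 * N * N') = n0^2 + n1^2 * Y"
    and eq6: "N' * X = v0^2 + v1^2 * Y"
    and eq7: "l0 * N' + L * S * N' + smult (a * b^2) (k1 * [:0, 1:] * N') + smult b (N' * X) = w0^2 + w1^2 * Y"
  shows "a * b^2 * d^2 = a' * b'^2 * d'^2 \<and> (a = a' \<and> b = b' \<and> c = c' \<and> d = d' \<longrightarrow> \<alpha> = 1 \<and> \<beta> = 0)"
proof -
  note [simp] = pderiv_add pderiv_smult pderiv_mult pderiv_square_char_two[OF char] pderiv_pCons
    add_self_char_two[OF char] 
  note two [simp] = char_two_eq_zero[OF char]
  have [simp]: "(2::'k poly) = 0" using char by (intro char_two_eq_zero) simp
  note move = sum_eqD_char_two[where 'a = "'k poly", unfolded semiring_char_poly, OF char]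
  have "a \<noteq> 0" "b \<noteq> 0" using nsq by (metis rangeI zero_power2)+
  hence ab: "a * b^2 \<noteq> 0" "a * b^2 * d \<noteq> 0" using nz by simp_all
  define n where "n = \<beta>^2 + d' * \<beta> + c' + a'"
  have N': "N' = [:n, d' * \<alpha>, \<alpha>^2:]"
    by (simp add: N'_def L_def square_pCons_char_two[OF char] n_def)
  have dN': "pderiv N' = [:d' * \<alpha>:]" by (simp add: N')
  have dN: "pderiv N = [:d:]" by (simp add: N_def)
  have dY: "pderiv Y = [:a * b^2 * d:]" by (simp add: Y_def dN)
  have Y: "Y = [:a * b^2 * (c + a), a * b^2 * d, a * b^2:]" by (simp add: Y_def N_def)
  have "smult (a * b^2 * d) (k^2) = [:a' * b'^2 * (d' * \<alpha>):]"
    using arg_cong[OF eq1, of pderiv] by (simp add: dY dN' mult_ac)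
  then obtain e where k: "k = [:e:]" and e: "a' * b'^2 * (d' * \<alpha>) = a * b^2 * d * e^2"
    using smult_square_eq_const[OF char, of "a * b^2 * d" k] ab by auto
  have "e \<noteq> 0" using e nz by auto
  have "smult (a * b^2 * d) (k1^2) = pderiv (k * N * N')" unfolding eq2 by (simp add: dY)
  also have "\<dots> = [:e * (d * n + d' * \<alpha> * (c + a)), 0, e * (d * \<alpha>^2 + d' * \<alpha>):]"
    by (simp add: dN dN' k) (simp add: N' N_def algebra_simps)
  finally obtain p q where k1: "k1 = [:p, q:]" 
    and p: "e * (d * n + d' * \<alpha> * (c + a)) = a * b^2 * d * p^2"
    and q: "e * (d * \<alpha>^2 + d' * \<alpha>) = a * b^2 * d * q^2"
    using smult_square_eq_linear[OF char, of "a * b^2 * d" k1] ab by auto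
  have "smult (a * b^2 * d) (m1^2) = pderiv (k1 * N * N')" unfolding eq4 by (simp add: dY)
  also have "\<dots> = [:q * (c + a) * n + p * (d * n + d' * \<alpha> * (c + a)),
      0,
      q * (n + d * (d' * \<alpha>) + (c + a) * \<alpha>^2) + p * (d * \<alpha>^2 + d' * \<alpha>),
      0, q * \<alpha>^2:]"
    by (simp add: dN dN' k1) (simp add: N' N_def algebra_simps)
  finally obtain m10 m11 m12 where m1: "m1 = [:m10, m11, m12:]"
    and m11: "q * (n + d * (d' * \<alpha>) + (c + a) * \<alpha>^2) + p * (d * \<alpha>^2 + d' * \<alpha>) = a * b^2 * d * m11^2"
    and m12: "q * \<alpha>^2 = a * b^2 * d * m12^2"
    using smult_square_eq_coeffs[OF char _ ab(2), of m1] by blast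
  have "m0^2 = k1 * N * N' + m1^2 * Y" using eq4 by (rule move)
  also have "\<dots> =
     [:p * (c + a) * n + a * b^2 * m10^2 * (c + a),
       q * (c + a) * n + p * (d * n + d' * \<alpha> * (c + a)) + a * b^2 * m10^2 * d,
       p * (n + d * (d' * \<alpha>) + (c + a) * \<alpha>^2) + q * (d * n + d' * \<alpha> * (c + a))
         + a * b^2 * (m10^2 + m11^2 * (c + a)),
       q * (n + d * (d' * \<alpha>) + (c + a) * \<alpha>^2) + p * (d * \<alpha>^2 + d' * \<alpha>) + a * b^2 * m11^2 * d,
       p * \<alpha>^2 + q * (d * \<alpha>^2 + d' * \<alpha>) + a * b^2 * (m11^2 + m12^2 * (c + a)),
       q * \<alpha>^2 + a * b^2 * m12^2 * d,
       a * b^2 * m12^2:]"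
    by (simp add: k1 N_def N' m1 Y square_pCons_char_two[OF char] algebra_simps)
  finally obtain m02 m03 where 
    m02: "p * \<alpha>^2 + q * (d * \<alpha>^2 + d' * \<alpha>) + a * b^2 * (m11^2 + m12^2 * (c + a)) = m02^2" and
    m03: "a * b^2 * m12^2 = m03^2"
    using square_eq_coeffs[OF char] by blast
  \<comment> \<open>The leading coefficients of the fourth equation make \<open>k\<^sub>1\<close> constant.\<close>
  have "a * (m12 * b)^2 = m03^2" using m03 by (simp add: power_mult_distrib mult_ac)
  hence "m12 = 0" using nonsquare_mult_square[OF nsq(1)] \<open>b \<noteq> 0\<close> by fastforce
  hence "q = 0" using m12 nz by simp
  have "e * \<alpha> * (d' + d * \<alpha>) = 0" using q \<open>q = 0\<close> by (simp add: algebra_simps power2_eq_square)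
  hence "d' + d * \<alpha> = 0" using nz \<open>e \<noteq> 0\<close> by simp
  hence d': "d' = d * \<alpha>" by (rule sum_eq_zeroD_char_two[OF char])
  have e': "a' * b'^2 * \<alpha>^2 = a * b^2 * e^2"
  proof -
    have "d * (a' * b'^2 * \<alpha>^2) = d * (a * b^2 * e^2)" using e d' by algebra
    thus ?thesis using nz by simp
  qed
  have "a * b^2 * d * m11^2 = 0" using m11 \<open>q = 0\<close> d' by (simp add: power2_eq_square)
  hence "m11 = 0" using ab by simp
  have m02: "p * \<alpha>^2 = m02^2" using m02 \<open>q = 0\<close> \<open>m11 = 0\<close> \<open>m12 = 0\<close> by simp
  have k1: "k1 = [:p:]" using k1 \<open>q = 0\<close> by simp
  have p: "e * (n + \<alpha>^2 * (c + a)) = a * b^2 * p^2"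
  proof -
    have "d * (e * (n + \<alpha>^2 * (c + a))) = d * (a * b^2 * p^2)" using p d' by algebra
    thus ?thesis using nz by simp
  qed

  have "S^2 = smult (a' * b'^2) N' + k^2 * Y" using eq1 by (rule move)
  also have "\<dots> = [:a' * b'^2 * n + e^2 * a * b^2 * (c + a), 
       a' * b'^2 * (d' * \<alpha>) + e^2 * a * b^2 * d, 0, 0, 0, 0, 0:]"
    using e' by (simp add: k N' Y square_pCons_char_two[OF char] algebra_simps)
  finally obtain s0 s1 s2 s3 where S: "S = [:s0, s1, s2, s3:]"
    and s0: "a' * b'^2 * n + e^2 * a * b^2 * (c + a) = s0^2"
    and s1: "0 = s1^2" and s2: "0 = s2^2" and s3: "0 = s3^2"
    using square_eq_coeffs[OF char] by blast
  have S: "S = [:s0:]" using S s1 s2 s3 by simp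

  have "k0^2 = k * N * N' + k1^2 * Y" using eq2 by (rule move)
  also have "\<dots> = [:e * (c + a) * n + p^2 * (a * b^2 * (c + a)),
      e * (d * n + d' * \<alpha> * (c + a)) + p^2 * (a * b^2 * d),
      e * (n + d * (d' * \<alpha>) + (c + a) * \<alpha>^2) + p^2 * (a * b^2),
      e * (d * \<alpha>^2 + d' * \<alpha>), e * \<alpha>^2, 0, 0:]"
    by (simp add: k N_def N' k1 Y square_pCons_char_two[OF char] algebra_simps)
  finally obtain x0 x1 x2 x3 where k0: "k0 = [:x0, x1, x2, x3:]"
    and x0: "e * (c + a) * n + p^2 * (a * b^2 * (c + a)) = x0^2"
    and x1: "e * (n + d * (d' * \<alpha>) + (c + a) * \<alpha>^2) + p^2 * (a * b^2) = x1^2"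
    and x2: "e * \<alpha>^2 = x2^2" and x3: "0 = x3^2"
    using square_eq_coeffs[OF char] by blast
  \<comment> \<open>This is the square root of \<open>e\<close>.\<close>
  define \<theta> where "\<theta> = x2 / \<alpha>"
  have x2': "x2 = \<alpha> * \<theta>" using nz by (simp add: \<theta>_def)
  have \<theta>: "e = \<theta>^2" using x2 nz by (simp add: \<theta>_def field_simps)
  have "x1^2 = (d * x2)^2 + 2 * (a * b^2 * p^2)" using x1 x2 p d' by algebra
  hence "x1^2 = (d * x2)^2" by simp
  hence "x1 = d * x2" using square_eq_iff_char_two[OF char] by blast
  hence k0: "k0 = [:x0, d * \<alpha> * \<theta>, \<alpha> * \<theta>:]" using k0 x2' x3 by simp

  have "smult (a * b^2 * d) (l1^2) = pderiv (N' * (S + smult b' N') + smult b (k * N * N'))"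
    unfolding eq3 by (simp add: dY)
  also have "\<dots> = [:d' * \<alpha> * s0 + b * (e * (d * n + d' * \<alpha> * (c + a))):]"
    by (simp add: dN dN' k S) (simp add: N' N_def d' algebra_simps power2_eq_square)
  finally obtain r where l1: "l1 = [:r:]" and 
     r: "d' * \<alpha> * s0 + b * (e * (d * n + d' * \<alpha> * (c + a))) = a * b^2 * d * r^2"
    using smult_square_eq_const[OF char _ ab(2), of l1] by blast

  \<comment> \<open>The leading coefficient of \<open>X\<close>; it vanishes exactly when \<open>e = 1\<close>.\<close>
  define y3 where "y3 = \<alpha> * \<theta> * (\<theta> + 1)"
  have "\<exists>y0 y1 y2. X = [:y0, y1, y2, y3:]"
    by (simp add: X_def l1 N_def L_def k k0 \<theta> y3_def algebra_simps power2_eq_square)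
  then obtain y0 y1 y2 where X: "X = [:y0, y1, y2, y3:]" by blast
  have "smult (a * b^2 * d) (v1^2) = pderiv (N' * X)"
    unfolding eq6 by (simp add: dY)
  also have "\<dots> = [:d' * \<alpha> * y0 + n * y1, 0, d' * \<alpha> * y2 + n * y3 + \<alpha>^2 * y1, 0, \<alpha>^2 * y3:]"
    by (simp add: dN' X) (simp add: N' algebra_simps)
  finally obtain v10 v11 v12 where v1: "v1 = [:v10, v11, v12:]"
    and v12: "\<alpha>^2 * y3 = a * b^2 * d * v12^2"
    using smult_square_eq_coeffs[OF char _ ab(2), of v1] by blast
  have "v0^2 = N' * X + v1^2 * Y" using eq6 by (rule move)
  also have "\<exists>z0 z1 z2 z3 z4 z5. \<dots> = [:z0, z1, z2, z3, z4, z5, a * b^2 * v12^2:]"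
    by (simp add: N' X v1 Y square_pCons_char_two[OF char] mult_ac)
  finally obtain v03 where v03: "a * b^2 * v12^2 = v03^2"
    using square_eq_coeffs[OF char] by blast
  have "a * (v12 * b)^2 = v03^2" using v03 by (simp add: power_mult_distrib mult_ac)
  hence "v12 = 0" using nonsquare_mult_square[OF nsq(1)] \<open>b \<noteq> 0\<close> by fastforce
  hence "\<theta> + 1 = 0" using v12 nz \<theta> \<open>e \<noteq> 0\<close> by (simp add: y3_def)
  hence "\<theta> = 1" by (rule sum_eq_zeroD_char_two[OF char])
  hence "e = 1" using \<theta> by simp
  show ?thesis
  proof (intro conjI impI)
    show "a * b^2 * d^2 = a' * b'^2 * d'^2" using e' d' \<open>e = 1\<close> by algebra
  next
    assume same: "a = a' \<and> b = b' \<and> c = c' \<and> d = d'"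
    with d' nz show \<alpha>: "\<alpha> = 1" by simp
    have m02: "p = m02^2" using m02 \<alpha> by simp
    have "smult (a * b^2 * d) (n1^2) = pderiv (k0 * N' + smult b (k1 * N * N'))"
      unfolding eq5 by (simp add: dY)
    also have "\<dots> = [:d * x0 + d * n + b * (p * (d * n + d * (c + a))):]"
      by (simp add: dN dN' k1) (use same in \<open>simp add: k0 N_def N' \<open>\<theta> = 1\<close> \<alpha> algebra_simps power2_eq_square\<close>)
    finally obtain n10 where n1: "n1 = [:n10:]" 
      using smult_square_eq_const[OF char _ ab(2), of n1] by blast
    have "n0^2 = k0 * N' + smult b (k1 * N * N') + n1^2 * Y" using eq5 by (rule move)
    also have "\<exists>z0 z1 z2 z3. \<dots> = [:z0, z1, z2, z3, 1 + b * p, 0, 0:]"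
      using same by (simp add: k0 \<open>\<theta> = 1\<close> \<alpha> k1 N_def N' n1 Y square_pCons_char_two[OF char] algebra_simps)
    finally obtain n02 where n02: "1 + b * p = n02^2"
      using square_eq_coeffs[OF char] by blast
    have "(n02 + 1)^2 = n02^2 + 1" using square_add_char_two[OF char, of n02 1] by simp
    also have "\<dots> = b * m02^2 + 2" using n02 m02 by algebra
    finally have "b * m02^2 = (n02 + 1)^2" by simp
    hence "m02 = 0" using nonsquare_mult_square[OF nsq(2)] by blast
    hence "p = 0" using m02 by simp
    hence "n + (c + a) = 0" using p \<open>e = 1\<close> \<alpha> by simp
    hence n: "n = c + a" by (rule sum_eq_zeroD_char_two[OF char])
    have N'N: "N' = N" using same by (simp add: N' N_def n \<alpha>)
    have "s0^2 = 0" using s0 same n \<open>e = 1\<close> by (simp add: algebra_simps)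
    hence "s0 = 0" by simp
    have "a * b^2 * d * r^2 = 0" using r \<open>s0 = 0\<close> n \<open>e = 1\<close> same \<alpha> by simp
    hence "r = 0" using ab by simp
    have k1: "k1 = 0" "k = 1" "S = 0" "l1 = 0"
      using k1 k S l1 \<open>p = 0\<close> \<open>e = 1\<close> \<open>s0 = 0\<close> \<open>r = 0\<close> by simp_all
    have "l0^2 = 0" using eq3 same by (simp add: k1 N'N power2_eq_square) 
    hence "l0 = 0" by simp
    have "k0^2 = N^2" using eq2 by (simp add: k1 N'N power2_eq_square)
    hence "k0 = N" using square_eq_iff_char_two[where 'a = "'k poly"] char by simp
    have X: "X = smult \<beta> N" by (simp add: X_def k1 \<open>k0 = N\<close> L_def \<alpha> algebra_simps)
    have NX: "N' * X = smult \<beta> (N^2)" by (simp add: X N'N power2_eq_square)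
    have "smult (a * b^2 * d) (v1^2) = pderiv (N' * X)"
      unfolding eq6 by (simp add: dY)
    hence "v1 = 0" using ab by (simp add: NX)
    have "smult (a * b^2 * d) (w1^2) = pderiv (smult b (N' * X))"
      using arg_cong[OF eq7, of pderiv] by (simp add: k1 \<open>l0 = 0\<close> dY)
    hence "w1 = 0" using ab by (simp add: NX)
    have square: "\<exists>y. x = y^2" if "smult x (N^2) = v^2" for x v
    proof -
      have "v^2 = [:x * (c + a)^2, 0, x * d^2, 0, x, 0, 0:]"
        unfolding that[symmetric] by (simp add: N_def square_pCons_char_two[OF char])
      thus ?thesis using square_eq_coeffs[OF char] by blast
    qed
    have "smult \<beta> (N^2) = v0^2" using eq6 NX \<open>v1 = 0\<close> by simp
    then obtain y where y: "\<beta> = y^2" using square by blast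
    have "smult (b * \<beta>) (N^2) = w0^2" using eq7 NX \<open>w1 = 0\<close> by (simp add: k1 \<open>l0 = 0\<close>)
    then obtain x where "b * \<beta> = x^2" using square by blast
    hence "y = 0" using nonsquare_mult_square[OF nsq(2)] y by blast
    thus "\<beta> = 0" using y by simp
  qed
qed

context char_two_extension
begin

text \<open>
  With \<open>s = y^2 + z\<close> and \<open>u = z^2 + b\<close> the quartic becomes
  \<open>s^2 + c u^2 + a z^4 = d u s\<close> where \<open>z^4 = u^2 + b^2\<close>, and dividing by \<open>u^2\<close> gives the equation
  for \<open>t = s / u\<close>. As in type (a), the equation solved for \<open>z\<close>, and its Frobenius images,
  place \<open>z\<close>, \<open>z^2\<close>, \<open>z^4\<close> in \<open>K(F^2)\<close>, \<open>K(F^4)\<close>, \<open>K(F^8)\<close>. In \<open>K(F^8)\<close> only \<open>u^2\<close>, \<open>s^2\<close> and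
  \<open>u s\<close> are available, which is enough for \<open>t = u s / u^2\<close>.
\<close>

lemma type_c_tower:
  assumes gen: "adjoin h {z, y} = UNIV" and tr: "transcendental_over h z"
    and rel: "quartic_c (h a) (h b) (h c) (h d) z y = 0" and nz: "a \<noteq> 0" "b \<noteq> 0" "d \<noteq> 0"
  obtains t u where "transcendental_over h t" "z^2 = u + h b" "y^2 = z + t * u"
    "u^2 * ev t [:c + a, d, 1:] = h (a * b^2)"
    "u^2 \<in> ratfun t"
    "\<forall>x. x \<in> quadratic_adjoin (quadratic_adjoin (quadratic_adjoin (ratfun t) u) z) y"
    "\<forall>x. x^2 \<in> quadratic_adjoin (quadratic_adjoin (ratfun t) u) z"
    "\<forall>x. x^4 \<in> quadratic_adjoin (ratfun t) u" "\<forall>x. x^8 \<in> ratfun t"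
    "z \<in> power_field 2"
    "u \<in> power_field 4"
    "t \<in> power_field 8"
proof -
  define u where "u = z^2 + h b"
  define s where "s = y^2 + z"
  define t where "t = s / u"
  have "u = ev z [:b, 0, 1:]" by (simp add: u_def power2_eq_square)
  hence "u \<noteq> 0" using tr unfolding transcendental_iff by (metis pCons_eq_0_iff one_neq_zero)
  hence s: "s = t * u" by (simp add: t_def)
  have z2: "z^2 = u + h b" using sum_eqD_char_two[OF char_top u_def] .
  have y2: "y^2 = z + t * u" using sum_eqD_char_two[OF char_top s_def] s by (simp add: add.commute)
  have u2: "u^2 = z^4 + (h b)^2" by (simp add: u_def square_add flip: power_mult)
  have s2: "s^2 = y^4 + z^2" by (simp add: s_def square_add flip: power_mult)
  have "(s^2 + h c * u^2 + h a * z^4) + h d * u * s = quartic_c (h a) (h b) (h c) (h d) z y"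
    unfolding u2 s2 unfolding u_def s_def quartic_c_def
    by (simp add: algebra_simps power2_eq_square power3_eq_cube power4_eq_xxxx)
  hence conic: "s^2 + h c * u^2 + h a * z^4 = h d * u * s"
    unfolding rel by (rule sum_eq_zeroD_char_two[OF char_top])
  have z4: "z^4 = u^2 + (h b)^2" using u2 by (rule sum_eqD_char_two[OF char_top])
  have n: "u^2 * ev t [:c + a, d, 1:] = h (a * b^2)"
  proof -
    have "u^2 * ev t [:c + a, d, 1:] = (s^2 + h c * u^2 + h a * u^2) + h d * u * s"
      unfolding s by (simp add: h_add algebra_simps power2_eq_square)
    also have "\<dots> = 2 * (s^2 + h c * u^2 + h a * u^2) + h a * (h b)^2"
      unfolding conic[symmetric] z4 by (simp add: algebra_simps)
    finally show ?thesis using char_two_eq_zero[OF char_top] by (simp add: h_mult h_power)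
  qed
  define P where "P = y^4 + h (c + a) * z^4 + h (b^2 * c)"
  have "(P + h d * u * y^2 + z^2) + h d * u * z = quartic_c (h a) (h b) (h c) (h d) z y"
    unfolding P_def u_def quartic_c_def h_mult h_power h_add
    by (simp add: algebra_simps power2_eq_square power3_eq_cube power4_eq_xxxx)
  hence zu: "P + h d * u * y^2 + z^2 = h d * u * z"
    unfolding rel by (rule sum_eq_zeroD_char_two[OF char_top])
  have du: "h d * u \<noteq> 0" using nz \<open>u \<noteq> 0\<close> by simp
  have zL: "z \<in> L" if L: "subfield_over h L" and sq: "\<And>x. x^2 \<in> L" for L
  proof -
    note D = subfield_overD[OF L]
    have "(x^2)^2 \<in> L" for x using sq .
    hence four: "x^4 \<in> L" for x by (simp flip: power_mult)
    have uL: "u \<in> L" unfolding u_def by (intro D(1,4) sq)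
    hence duL: "h d * u \<in> L" by (intro D(1,5))
    have "P + h d * u * y^2 + z^2 \<in> L" unfolding P_def by (intro D(1,4,5) sq four uL)
    hence "h d * u * z / (h d * u) \<in> L" unfolding zu using duL by (rule D(9))
    thus ?thesis using du by simp
  qed
  have zu2: "(h d * u * z)^2 = P^2 + (h d * u)^2 * y^4 + z^4"
    unfolding zu[symmetric] square_add by (simp add: power_mult_distrib flip: power_mult)
  have z2L: "z^2 \<in> L" if L: "subfield_over h L" and four: "\<And>x. x^4 \<in> L" for L
  proof -
    note D = subfield_overD[OF L]
    have u2L: "u^2 \<in> L" unfolding u2 by (intro D(1,4,10) four)
    have duL: "(h d * u)^2 \<in> L" unfolding power_mult_distrib by (intro D(1,5,10) u2L)
    have PL: "P \<in> L" unfolding P_def by (intro D(1,4,5) four)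
    have "(h d * u * z)^2 \<in> L" unfolding zu2 by (intro D(4,5,10) PL duL four)
    hence "(h d * u * z)^2 / (h d * u)^2 \<in> L" using duL by (rule D(9))
    thus ?thesis using du by (simp add: power_mult_distrib)
  qed
  have uL: "u \<in> L" if L: "subfield_over h L" and four: "\<And>x. x^4 \<in> L" for L
    unfolding u_def by (intro subfield_overD(1,4)[OF L] z2L[OF L four])
  have tL: "t \<in> L" if L: "subfield_over h L" and eight: "\<And>x. x^8 \<in> L" for L
  proof -
    note D = subfield_overD[OF L]
    have pow: "(x^4)^2 = x^8" "(x^2)^4 = x^8" "(x^2)^2 = x^4" for x :: 'f by (simp_all flip: power_mult)
    have u4: "u^4 = z^8 + (h b)^4"
      unfolding pow(3)[symmetric, of u] u2 square_add by (simp flip: power_mult)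
    have u4L: "u^4 \<in> L" unfolding u4 by (intro D(1,4,10) eight)
    have P2: "P^2 = y^8 + (h (c + a))^2 * z^8 + (h (b^2 * c))^2"
      unfolding P_def square_add power_mult_distrib pow ..
    have P2L: "P^2 \<in> L" unfolding P2 by (intro D(1,4,5,10) eight)
    have du4: "((h d * u)^2)^2 = (h d)^4 * u^4" by (simp add: power_mult_distrib flip: power_mult)
    have du4L: "((h d * u)^2)^2 \<in> L" unfolding du4 by (intro D(1,5,10) u4L)
    have "((h d * u)^2)^2 * z^4 = ((h d * u * z)^2)^2" by (simp add: power_mult_distrib flip: power_mult)
    also have "\<dots> = (P^2)^2 + ((h d * u)^2)^2 * y^8 + z^8"
      unfolding zu2 unfolding square_add unfolding power_mult_distrib pow ..
    also have "\<dots> \<in> L" by (intro D(4,5,10) P2L du4L eight)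
    finally have "((h d * u)^2)^2 * z^4 / ((h d * u)^2)^2 \<in> L" using du4L by (rule D(9))
    hence z4L: "z^4 \<in> L" using du by simp
    have u2L: "u^2 \<in> L" unfolding u2 by (intro D(1,4,10) z4L)
    have s4: "(s^2)^2 = y^8 + z^4" unfolding s2 square_add pow ..
    have s4L: "(s^2)^2 \<in> L" unfolding s4 by (intro D(4) eight z4L)
    have du2L: "(h d * u)^2 \<in> L" unfolding power_mult_distrib by (intro D(1,5,10) u2L)
    have "(h d * u)^2 * s^2 = (h d * u * s)^2" by (simp add: power_mult_distrib)
    also have "\<dots> = (s^2)^2 + (h c)^2 * (u^2)^2 + (h a)^2 * z^8"
      unfolding conic[symmetric] unfolding square_add unfolding power_mult_distrib pow ..
    also have "\<dots> \<in> L" by (intro D(1,4,5,10) s4L u2L eight)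
    finally have "(h d * u)^2 * s^2 / (h d * u)^2 \<in> L" using du2L by (rule D(9))
    hence s2L: "s^2 \<in> L" using du by simp
    have "h d * u * s \<in> L" unfolding conic[symmetric] by (intro D(1,4,5) s2L u2L z4L)
    hence "h d * u * s / (h d * u^2) \<in> L" by (rule D(9)) (intro D(1,5) u2L)
    thus ?thesis using du by (simp add: s power2_eq_square)
  qed
  note E = subfield_over_ratfun[of t] and D = subfield_overD[OF subfield_over_ratfun[of t]]
  have "ev t [:c + a, d, 1:] \<noteq> 0" using n nz by auto
  hence "u^2 = h (a * b^2) / ev t [:c + a, d, 1:]" using n by (simp add: field_simps)
  also have "\<dots> \<in> ratfun t" by (intro D(1,9) ev_in_ratfun)
  finally have u2E: "u^2 \<in> ratfun t" .
  have z4E: "(z^2)^2 \<in> ratfun t" unfolding z2 square_add by (intro D(1,4,10) u2E)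
  have tt: "transcendental_over h t"
    using algebraic_ratfun[OF _ z4E] transcendental_square[OF transcendental_square[OF tr]] by blast
  note F2 = subfield_over_quadratic_adjoin[OF E u2E]
  note F2D = subfield_overD[OF F2]
  have uF2: "u \<in> quadratic_adjoin (ratfun t) u" by (rule quadratic_adjoin_mem[OF E])
  have z2F2: "z^2 \<in> quadratic_adjoin (ratfun t) u" unfolding z2 by (intro F2D(1,4) uF2)
  note F1 = subfield_over_quadratic_adjoin[OF F2 z2F2]
  note F1D = subfield_overD[OF F1]
  have zF1: "z \<in> quadratic_adjoin (quadratic_adjoin (ratfun t) u) z" by (rule quadratic_adjoin_mem[OF F2])
  have y2F1: "y^2 \<in> quadratic_adjoin (quadratic_adjoin (ratfun t) u) z"
    unfolding y2 by (intro F1D(4,5) zF1 quadratic_adjoin_mem(2)[OF F2] uF2 quadratic_adjoin_mem(2)[OF E] generator_in_ratfun)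
  have all: "x \<in> quadratic_adjoin (quadratic_adjoin (quadratic_adjoin (ratfun t) u) z) y" for x
    by (rule adjoin_induct[OF gen subfield_over_quadratic_adjoin[OF F1 y2F1]])
      (intro quadratic_adjoin_mem[OF F1] zF1)+
  have sq: "x^2 \<in> quadratic_adjoin (quadratic_adjoin (ratfun t) u) z" for x
    by (rule quadratic_adjoin_square[OF F1 y2F1 all])
  have four: "x^4 \<in> quadratic_adjoin (ratfun t) u" for x
    using quadratic_adjoin_square[OF F2 z2F2 sq[of x]] by (simp flip: power_mult)
  have eight: "x^8 \<in> ratfun t" for x
    using quadratic_adjoin_square[OF E u2E four[of x]] by (simp flip: power_mult)
  show ?thesis 
    using that[OF tt z2 y2 n u2E] all sq four eight power_fieldI[OF zL] power_fieldI[OF uL]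
      power_fieldI[OF tL] by blast
qed

text \<open>
  The coordinates of \<open>u'\<close>, \<open>z'\<close>, \<open>y'\<close> in the tower
  \<open>K(t) \<subseteq> K(t)(u) \<subseteq> K(t)(u, z) \<subseteq> F\<close>, scaled by the denominators \<open>N\<close> and \<open>N'\<close> of \<open>u^2\<close> and
  \<open>u'^2\<close>, satisfy the equations of \<open>type_c_core\<close>.
\<close>

lemma type_c_generators_rigid:
  assumes gen: "adjoin h {z, y} = UNIV" and tr: "transcendental_over h z"
    and rel: "quartic_c (h a) (h b) (h c) (h d) z y = 0" and nsq: "a \<notin> squares" "b \<notin> squares" and d: "d \<noteq> 0"
    and gen': "adjoin h {z', y'} = UNIV" and tr': "transcendental_over h z'"
    and rel': "quartic_c (h a') (h b') (h c') (h d') z' y' = 0" and nsq': "a' \<notin> squares" "b' \<notin> squares" and d': "d' \<noteq> 0"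
  shows "a * b^2 * d^2 = a' * b'^2 * d'^2 \<and> (a = a' \<and> b = b' \<and> c = c' \<and> d = d' \<longrightarrow> z = z' \<and> y = y')"
proof -
  have nz: "a \<noteq> 0" "b \<noteq> 0" "a' \<noteq> 0" "b' \<noteq> 0" using nsq nsq' by (metis rangeI zero_power2)+
  obtain t u where t: "transcendental_over h t" and z2: "z^2 = u + h b" and y2: "y^2 = z + t * u"
    and n: "u^2 * ev t [:c + a, d, 1:] = h (a * b^2)" and u2E: "u^2 \<in> ratfun t"
    and all: "\<forall>x. x \<in> quadratic_adjoin (quadratic_adjoin (quadratic_adjoin (ratfun t) u) z) y"
    and sq: "\<forall>x. x^2 \<in> quadratic_adjoin (quadratic_adjoin (ratfun t) u) z"
    and four: "\<forall>x. x^4 \<in> quadratic_adjoin (ratfun t) u" and eight: "\<forall>x. x^8 \<in> ratfun t"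
    and tP: "t \<in> power_field 8"
    using type_c_tower[OF gen tr rel nz(1,2) d] by metis
  obtain t' u' where z2': "z'^2 = u' + h b'" and y2': "y'^2 = z' + t' * u'"
    and n': "u'^2 * ev t' [:c' + a', d', 1:] = h (a' * b'^2)" and eight': "\<forall>x. x^8 \<in> ratfun t'"
    and zP': "z' \<in> power_field 2" and uP': "u' \<in> power_field 4" and tP': "t' \<in> power_field 8"
    using type_c_tower[OF gen' tr' rel' nz(3,4) d'] by metis
  note E = subfield_over_ratfun[of t] and D = subfield_overD[OF subfield_over_ratfun[of t]]
  define N where "N = [:c + a, d, 1:]"
  define Y where "Y = smult (a * b^2) N"
  \<comment> \<open>Multiplication by \<open>\<nu>\<close> turns \<open>u\<close> into a square root of the polynomial \<open>Y\<close>.\<close>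
  define \<nu> where "\<nu> = ev t N"
  have n: "u^2 * \<nu> = h (a * b^2)" using n by (simp only: \<nu>_def N_def)
  have \<nu>: "\<nu> \<noteq> 0" using n nz by auto
  have \<nu>E: "\<nu> \<in> ratfun t" by (simp add: \<nu>_def)
  have evY: "ev t Y = (\<nu> * u)^2"
    unfolding Y_def ev_smult n[symmetric] \<nu>_def[symmetric] by (simp add: power2_eq_square)
  have dY: "pderiv Y = [:a * b^2 * d:]"
    by (simp add: Y_def N_def pderiv_smult pderiv_pCons add_self_char_two[OF char])
  have e: "a * b^2 * d \<noteq> 0" using nz d by simp
  note polys = polynomial_from_square_sum[OF t _ _ dY e]
  have unE: "u \<notin> ratfun t"
  proof
    assume "u \<in> ratfun t"
    hence "\<nu> * u \<in> ratfun t" using D(5) \<nu>E by blast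
    moreover have "pderiv Y \<noteq> 0" using e dY by simp
    ultimately show False using not_square_in_ratfun[OF t _ evY[symmetric]] by blast
  qed
  define F2 where "F2 = quadratic_adjoin (ratfun t) u"
  define F1 where "F1 = quadratic_adjoin F2 z"
  have F2: "subfield_over h F2" unfolding F2_def by (rule subfield_over_quadratic_adjoin[OF E u2E])
  note F2D = subfield_overD[OF F2]
  have EF2: "x \<in> F2" if "x \<in> ratfun t" for x unfolding F2_def using that by (rule quadratic_adjoin_mem(2)[OF E])
  have uF2: "u \<in> F2" unfolding F2_def by (rule quadratic_adjoin_mem[OF E])
  have z2F2: "z^2 \<in> F2" unfolding z2 by (intro F2D(1,4) uF2)
  have sqF2: "x^2 \<in> ratfun t" if "x \<in> F2" for x
    using quadratic_adjoin_square[OF E u2E] that unfolding F2_def by blast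
  have znF2: "z \<notin> F2"
  proof
    assume "z \<in> F2"
    hence "z^2 - h b \<in> ratfun t" by (intro D(1,8) sqF2)
    thus False using unE by (simp add: z2)
  qed
  have F1: "subfield_over h F1" unfolding F1_def by (rule subfield_over_quadratic_adjoin[OF F2 z2F2])
  have sqF1: "x^2 \<in> F2" if "x \<in> F1" for x
    using quadratic_adjoin_square[OF F2 z2F2] that unfolding F1_def by blast
  have t'E: "t' \<in> ratfun t" by (rule power_fieldD[OF tP' E]) (use eight in blast)
  have tE': "t \<in> ratfun t'" by (rule power_fieldD[OF tP subfield_over_ratfun]) (use eight' in blast)
  obtain \<alpha> \<beta> \<gamma> \<delta> where norm: "\<gamma> = 0 \<and> \<delta> = 1 \<or> \<gamma> = 1" and det: "\<alpha> * \<delta> \<noteq> \<beta> * \<gamma>"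
    and M0: "ev t [:\<delta>, \<gamma>:] \<noteq> 0" and t'eq: "t' = ev t [:\<beta>, \<alpha>:] / ev t [:\<delta>, \<gamma>:]"
    using generators_of_rational_function_field[OF t t'E tE'] by blast
  define L M where "L = [:\<beta>, \<alpha>:]" and "M = [:\<delta>, \<gamma>:]"
  define m where "m = ev t M"
  have m: "m \<noteq> 0" "t' * m = ev t L" using M0 t'eq by (simp_all add: m_def M_def L_def)
  define N' where "N' = L^2 + smult d' (L * M) + smult (c' + a') (M^2)"
  define \<nu>' where "\<nu>' = ev t N'"
  have \<nu>'E: "\<nu>' \<in> ratfun t" by (simp add: \<nu>'_def)
  have n': "u'^2 * \<nu>' = h (a' * b'^2) * m^2"
    unfolding n'[symmetric] \<nu>'_def N'_def
    by (simp add: m(2)[symmetric] m_def[symmetric] algebra_simps power2_eq_square)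
  have \<nu>': "\<nu>' \<noteq> 0" using n' nz m by auto
  \<comment> \<open>Squares of elements of \<open>F2\<close> take the shape \<open>R\<^sub>0^2 + R\<^sub>1^2 Y\<close> after scaling by \<open>\<nu>'^2\<close>.\<close>
  have scale: "\<nu>'^2 * (p + q * u)^2 = (p * \<nu>')^2 + (q * \<nu>' / \<nu>)^2 * ev t Y" for p q
    unfolding evY square_add using \<nu> by (simp add: field_simps power_mult_distrib)
  have polys': "\<exists>k0 k1. p * \<nu>' = ev t k0 \<and> q * \<nu>' / \<nu> = ev t k1 \<and> X = k0^2 + k1^2 * Y"
    if "ev t X = \<nu>'^2 * (p + q * u)^2" "p \<in> ratfun t" "q \<in> ratfun t" for X p q
    by (rule polys) (use that scale in \<open>auto intro!: D(5,9) \<nu>E \<nu>'E\<close>)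
  obtain A B where u': "u' = A + B * u" and A: "A \<in> ratfun t" and B: "B \<in> ratfun t"
    using power_fieldD[OF uP' F2] four unfolding F2_def by (metis quadratic_adjoinE)
  have "ev t (smult (a' * b'^2) (M^2 * N')) = \<nu>'^2 * (A + B * u)^2"
    unfolding u'[symmetric]
    using n' by (simp add: m_def[symmetric] \<nu>'_def[symmetric] power2_eq_square mult_ac)
  from polys'[OF this A B] obtain S k where S: "A * \<nu>' = ev t S" and k: "B * \<nu>' / \<nu> = ev t k"
    and eq1: "smult (a' * b'^2) (M^2 * N') = S^2 + k^2 * Y" by blast
  have k': "ev t k * \<nu> = B * \<nu>'" using k[symmetric] \<nu> by simp
  obtain C G where z': "z' = C + G * z" and C: "C \<in> F2" and G: "G \<in> F2"
    using power_fieldD[OF zP' F1] sq unfolding F1_def F2_def by (metis quadratic_adjoinE)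
  obtain C0 C1 where Ceq: "C = C0 + C1 * u" and C0: "C0 \<in> ratfun t" and C1: "C1 \<in> ratfun t"
    using C unfolding F2_def by (rule quadratic_adjoinE)
  obtain G0 G1 where Geq: "G = G0 + G1 * u" and G0: "G0 \<in> ratfun t" and G1: "G1 \<in> ratfun t"
    using G unfolding F2_def by (rule quadratic_adjoinE)
  have "(A + h b') + B * u = (C^2 + G^2 * h b) + G^2 * u"
  proof -
    have "(A + h b') + B * u = z'^2" unfolding z2' u' by (simp add: algebra_simps)
    also have "\<dots> = C^2 + G^2 * (u + h b)" unfolding z' square_add power_mult_distrib z2 ..
    finally show ?thesis by (simp add: algebra_simps)
  qed
  from quadratic_adjoin_unique[OF E unE _ B _ _ this]
  have cmp: "A + h b' = C^2 + G^2 * h b" "B = G^2"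
    using A C G sqF2 D(1,4,5) by meson+
  have C2: "A + h b' + h b * B = C^2"
    unfolding cmp(1) cmp(2)[symmetric] by (simp add: add_self_char_two[OF char_top] mult.commute add.assoc)
  have evkNN: "ev t (k * N * N') = \<nu>'^2 * B"
    using k' by (simp add: \<nu>_def[symmetric] \<nu>'_def[symmetric] power2_eq_square)
  have "ev t (k * N * N') = \<nu>'^2 * (G0 + G1 * u)^2"
    unfolding evkNN cmp(2) Geq ..
  from polys'[OF this G0 G1] obtain k0 k1 where k0: "G0 * \<nu>' = ev t k0" and k1: "G1 * \<nu>' / \<nu> = ev t k1"
    and eq2: "k * N * N' = k0^2 + k1^2 * Y" by blast
  have k1': "ev t k1 * \<nu> = G1 * \<nu>'" using k1[symmetric] \<nu> by simp
  have "ev t (N' * (S + smult b' N') + smult b (k * N * N')) = \<nu>'^2 * (A + h b' + h b * B)"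
    unfolding ev_add ev_smult evkNN by (simp add: S[symmetric] \<nu>'_def[symmetric] algebra_simps power2_eq_square)
  also have "\<dots> = \<nu>'^2 * (C0 + C1 * u)^2" unfolding C2 Ceq ..
  finally have "ev t (N' * (S + smult b' N') + smult b (k * N * N')) = \<nu>'^2 * (C0 + C1 * u)^2" .
  from polys'[OF this C0 C1] obtain l0 l1 where l0: "C0 * \<nu>' = ev t l0" and l1: "C1 * \<nu>' / \<nu> = ev t l1"
    and eq3: "N' * (S + smult b' N') + smult b (k * N * N') = l0^2 + l1^2 * Y" by blast
  have l1': "ev t l1 * \<nu> = C1 * \<nu>'" using l1[symmetric] \<nu> by simp
  have "\<gamma> \<noteq> 1"
  proof
    assume "\<gamma> = 1"
    with det have "\<alpha> * \<delta> \<noteq> \<beta>" by simp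
    from type_c_affine[OF char nsq(1) nsq'(2) nz(3,4,2) d d' this] eq1 eq2 eq3 show False
      unfolding N'_def L_def M_def Y_def N_def \<open>\<gamma> = 1\<close> by blast
  qed
  with norm have \<gamma>: "\<gamma> = 0" "\<delta> = 1" by auto
  with det have \<alpha>: "\<alpha> \<noteq> 0" by simp
  have M: "M = 1" by (simp add: M_def \<gamma> one_pCons)
  have m1: "m = 1" by (simp add: m_def M)
  have tL: "t' = ev t L" using m by (simp add: m1)
  have n': "u'^2 * \<nu>' = h (a' * b'^2)" using n' by (simp add: m1)
  have N'eq: "N' = L^2 + smult d' L + [:c' + a':]" by (simp add: N'_def M)

  \<comment> \<open>From here on the coordinates of \<open>y'\<close>, which \<open>t' = \<alpha> t + \<beta>\<close> turns into polynomial equations.\<close>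
  obtain H J where y': "y' = H + J * y" and H: "H \<in> F1" and J: "J \<in> F1"
    using all[rule_format, of y'] unfolding F1_def F2_def by (rule quadratic_adjoinE)
  obtain H0 H1 where Heq: "H = H0 + H1 * z" and H0: "H0 \<in> F2" and H1: "H1 \<in> F2"
    using H unfolding F1_def by (rule quadratic_adjoinE)
  obtain J0 J1 where Jeq: "J = J0 + J1 * z" and J0: "J0 \<in> F2" and J1: "J1 \<in> F2"
    using J unfolding F1_def by (rule quadratic_adjoinE)
  have H2: "H^2 = (H0^2 + H1^2 * h b) + H1^2 * u"
    unfolding Heq square_add power_mult_distrib z2 by (simp add: algebra_simps)
  have J2: "J^2 = (J0^2 + J1^2 * h b) + J1^2 * u"
    unfolding Jeq square_add power_mult_distrib z2 by (simp add: algebra_simps)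
  have "(C + t' * (A + B * u)) + G * z = (H^2 + J^2 * t * u) + J^2 * z"
  proof -
    have "(C + t' * (A + B * u)) + G * z = y'^2" unfolding y2' z' u' by (simp add: algebra_simps)
    also have "\<dots> = H^2 + J^2 * (z + t * u)" unfolding y' square_add power_mult_distrib y2 ..
    finally show ?thesis by (simp add: algebra_simps)
  qed
  moreover have "C + t' * (A + B * u) \<in> F2" by (intro F2D(4,5) C EF2 t'E A B uF2)
  moreover have "H^2 + J^2 * t * u \<in> F2" by (intro F2D(4,5) sqF1 H J EF2 generator_in_ratfun uF2)
  ultimately have top: "C + t' * (A + B * u) = H^2 + J^2 * t * u" "G = J^2"
    using quadratic_adjoin_unique[OF F2 znF2 _ G _ sqF1[OF J]] by blast+
  have sqE: "x^2 * h b \<in> ratfun t" "x^2 \<in> ratfun t" if "x \<in> F2" for x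
    using sqF2[OF that] D(1,5) by blast+
  have "G0 + G1 * u = (J0^2 + J1^2 * h b) + J1^2 * u"
    using top(2) unfolding Geq J2 .
  from quadratic_adjoin_unique[OF E unE G0 G1 _ _ this]
  have G01: "G0 = J0^2 + J1^2 * h b" "G1 = J1^2"
    using sqE[OF J0] sqE[OF J1] D(4) by blast+
  have "(C0 + t' * A) + (C1 + t' * B) * u
      = (H0^2 + H1^2 * h b + G1 * t * u^2) + (H1^2 + G0 * t) * u"
    using top(1) unfolding top(2)[symmetric] Ceq Geq H2 by (simp add: algebra_simps power2_eq_square)
  moreover have "C0 + t' * A \<in> ratfun t" "C1 + t' * B \<in> ratfun t"
    "H0^2 + H1^2 * h b + G1 * t * u^2 \<in> ratfun t" "H1^2 + G0 * t \<in> ratfun t"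
    by (intro D(4,5) C0 C1 A B t'E sqE H0 H1 G0 G1 u2E generator_in_ratfun)+
  ultimately have bot: "C0 + t' * A = H0^2 + H1^2 * h b + G1 * t * u^2" "C1 + t' * B = H1^2 + G0 * t"
    using quadratic_adjoin_unique[OF E unE] by blast+
  obtain p0 p1 where J1eq: "J1 = p0 + p1 * u" and p0: "p0 \<in> ratfun t" and p1: "p1 \<in> ratfun t"
    using J1 unfolding F2_def by (rule quadratic_adjoinE)
  have evk1: "ev t (k1 * N * N') = \<nu>'^2 * G1"
    using k1' by (simp add: \<nu>_def[symmetric] \<nu>'_def[symmetric] power2_eq_square)
  have "ev t (k1 * N * N') = \<nu>'^2 * (p0 + p1 * u)^2" unfolding evk1 G01 J1eq ..
  from polys'[OF this p0 p1] obtain m0 m1 where eq4: "k1 * N * N' = m0^2 + m1^2 * Y" by blast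
  obtain q0 q1 where J0eq: "J0 = q0 + q1 * u" and q0: "q0 \<in> ratfun t" and q1: "q1 \<in> ratfun t"
    using J0 unfolding F2_def by (rule quadratic_adjoinE)
  have G0b: "G0 + h b * G1 = J0^2"
    unfolding G01 by (simp add: add_self_char_two[OF char_top] mult.commute add.assoc)
  have "ev t (k0 * N' + smult b (k1 * N * N')) = \<nu>'^2 * (G0 + h b * G1)"
    unfolding ev_add ev_smult evk1 by (simp add: k0[symmetric] \<nu>'_def[symmetric] algebra_simps power2_eq_square)
  also have "\<dots> = \<nu>'^2 * (q0 + q1 * u)^2" unfolding G0b J0eq ..
  finally have "ev t (k0 * N' + smult b (k1 * N * N')) = \<nu>'^2 * (q0 + q1 * u)^2" .
  from polys'[OF this q0 q1] obtain n0 n1 where eq5: "k0 * N' + smult b (k1 * N * N') = n0^2 + n1^2 * Y" by blast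
  define X where "X = l1 * N + L * k * N + k0 * [:0, 1:]"
  obtain r0 r1 where H1eq: "H1 = r0 + r1 * u" and r0: "r0 \<in> ratfun t" and r1: "r1 \<in> ratfun t"
    using H1 unfolding F2_def by (rule quadratic_adjoinE)
  have H1s: "C1 + t' * B + G0 * t = H1^2"
    unfolding bot(2) by (simp add: add_self_char_two[OF char_top] add.assoc)
  have "ev t X = \<nu>' * (C1 + t' * B + G0 * t)"
  proof -
    have "ev t X = ev t l1 * \<nu> + t' * (ev t k * \<nu>) + ev t k0 * t"
      by (simp add: X_def \<nu>_def tL)
    thus ?thesis unfolding k' l1' k0[symmetric] by (simp add: algebra_simps)
  qed
  hence evX: "ev t (N' * X) = \<nu>'^2 * H1^2"
    unfolding H1s by (simp add: \<nu>'_def power2_eq_square)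
  have "ev t (N' * X) = \<nu>'^2 * (r0 + r1 * u)^2" unfolding evX H1eq ..
  from polys'[OF this r0 r1] obtain v0 v1 where eq6: "N' * X = v0^2 + v1^2 * Y" by blast
  obtain s0 s1 where H0eq: "H0 = s0 + s1 * u" and s0: "s0 \<in> ratfun t" and s1: "s1 \<in> ratfun t"
    using H0 unfolding F2_def by (rule quadratic_adjoinE)
  have H0s: "C0 + t' * A + G1 * t * u^2 + h b * H1^2 = H0^2"
  proof -
    have "C0 + t' * A + G1 * t * u^2 + h b * H1^2 = H0^2 + 2 * (H1^2 * h b + G1 * t * u^2)"
      unfolding bot(1) by (simp add: algebra_simps)
    thus ?thesis using char_two_eq_zero[OF char_top] by simp
  qed
  have "ev t (l0 * N' + L * S * N' + smult (a * b^2) (k1 * [:0, 1:] * N') + smult b (N' * X))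
     = ev t l0 * \<nu>' + t' * ev t S * \<nu>' + u^2 * (ev t k1 * \<nu>) * t * \<nu>' + h b * (\<nu>'^2 * H1^2)"
    unfolding ev_add ev_smult evX by (simp add: tL \<nu>'_def n[symmetric])
  also have "\<dots> = \<nu>'^2 * (C0 + t' * A + G1 * t * u^2 + h b * H1^2)"
    unfolding k1' l0[symmetric] S[symmetric] by (simp add: algebra_simps power2_eq_square)
  also have "\<dots> = \<nu>'^2 * (s0 + s1 * u)^2" unfolding H0s H0eq ..
  finally have "ev t (l0 * N' + L * S * N' + smult (a * b^2) (k1 * [:0, 1:] * N') + smult b (N' * X)) =
    \<nu>'^2 * (s0 + s1 * u)^2" .
  from polys'[OF this s0 s1] obtain w0 w1 where
    eq7: "l0 * N' + L * S * N' + smult (a * b^2) (k1 * [:0, 1:] * N') + smult b (N' * X) = w0^2 + w1^2 * Y"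
    by blast
  have eq1: "smult (a' * b'^2) N' = S^2 + k^2 * Y" using eq1 by (simp add: M)
  have core: "a * b^2 * d^2 = a' * b'^2 * d'^2 \<and> (a = a' \<and> b = b' \<and> c = c' \<and> d = d' \<longrightarrow> \<alpha> = 1 \<and> \<beta> = 0)"
    by (rule type_c_core[OF char nsq d d' \<alpha> nz(3,4) eq1[unfolded N'eq L_def N_def Y_def]
        eq2[unfolded N'eq L_def N_def Y_def] eq3[unfolded N'eq L_def N_def Y_def]
        eq4[unfolded N'eq L_def N_def Y_def] eq5[unfolded N'eq L_def N_def Y_def]
        eq6[unfolded X_def N'eq L_def N_def Y_def] eq7[unfolded X_def N'eq L_def N_def Y_def]])
  show ?thesis
  proof (intro conjI impI)
    assume same: "a = a' \<and> b = b' \<and> c = c' \<and> d = d'"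
    with core have "t' = t" by (simp add: tL L_def)
    have "N' = N" using core same by (simp add: N'eq L_def N_def power2_eq_square)
    hence "u'^2 * \<nu> = u^2 * \<nu>" using n n' same by (simp add: \<nu>_def \<nu>'_def)
    hence "u'^2 = u^2" using \<nu> by simp
    hence u': "u' = u" using square_eq_iff_char_two[OF char_top] by blast
    hence "z^2 = z'^2" using same by (simp add: z2 z2')
    thus z': "z = z'" using square_eq_iff_char_two[OF char_top] by blast
    have "y^2 = y'^2" by (simp add: y2 y2' z' u' \<open>t' = t\<close>)
    thus "y = y'" using square_eq_iff_char_two[OF char_top] by blast
  qed (use core in blast)
qed

end

section \<open>Isomorphisms and automorphisms\<close>

locale char_two_isomorphism = char_two_extension h
  for h :: "'k::field \<Rightarrow> 'f::field" +
  fixes h' :: "'k \<Rightarrow> 'g::field" and \<sigma> :: "'f \<Rightarrow> 'g"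
  assumes ext': "field_extension h'" and iso: "K_isomorphism h h' \<sigma>"
begin

sublocale target: char_two_extension h'
  using ext' char by unfold_locales

sublocale sigma: char_two_extension \<sigma>
  using iso char_top by unfold_locales (auto simp: K_isomorphism_def)

lemma sigma_h: "\<sigma> (h x) = h' x" and sigma_surj: "surj \<sigma>"
  using iso by (auto simp: K_isomorphism_def bij_def)

text \<open>
  The preimage under \<open>\<sigma>\<close> of a subfield of the target is a subfield of the source.
\<close>

lemma generators_transport:
  assumes "adjoin h {z, y} = UNIV"
  shows "adjoin h' {\<sigma> z, \<sigma> y} = UNIV"
proof -
  have "v \<in> L" if L: "subfield_over h' L" and zy: "\<sigma> z \<in> L" "\<sigma> y \<in> L" for L v
  proof -
    note D = target.subfield_overD[OF L]
    have "subfield_over h {x. \<sigma> x \<in> L}"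
      by (intro subfield_overI) (simp_all add: sigma_h sigma.h_add sigma.h_mult sigma.h_inverse D)
    hence "x \<in> {x. \<sigma> x \<in> L}" for x
      by (rule adjoin_induct[OF assms]) (use zy in simp_all)
    moreover obtain x where "v = \<sigma> x" using sigma_surj by blast
    ultimately show ?thesis by simp
  qed
  thus ?thesis unfolding adjoin_def subfield_over_def by auto
qed

lemma transcendental_transport:
  assumes "transcendental_over h z"
  shows "transcendental_over h' (\<sigma> z)"
proof -
  have "target.ev (\<sigma> z) p = \<sigma> (ev z p)" for p
    by (induction p) (simp_all add: sigma.h_add sigma.h_mult sigma_h)
  thus ?thesis using assms by (simp add: transcendental_iff target.transcendental_iff)
qed

lemma quartic_transport:
  "quartic_a (h a) (h b) (h c) (h d) z y = 0 \<Longrightarrow> quartic_a (h' a) (h' b) (h' c) (h' d) (\<sigma> z) (\<sigma> y) = 0"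
  "quartic_b (h a) (h b) (h c) z y = 0 \<Longrightarrow> quartic_b (h' a) (h' b) (h' c) (\<sigma> z) (\<sigma> y) = 0"
  "quartic_c (h a) (h b) (h c) (h d) z y = 0 \<Longrightarrow> quartic_c (h' a) (h' b) (h' c) (h' d) (\<sigma> z) (\<sigma> y) = 0"
proof -
  note hom = sigma.h_add sigma.h_mult sigma.h_power sigma_h
  have "quartic_a (h' a) (h' b) (h' c) (h' d) (\<sigma> z) (\<sigma> y) = \<sigma> (quartic_a (h a) (h b) (h c) (h d) z y)"
    "quartic_b (h' a) (h' b) (h' c) (\<sigma> z) (\<sigma> y) = \<sigma> (quartic_b (h a) (h b) (h c) z y)"
    "quartic_c (h' a) (h' b) (h' c) (h' d) (\<sigma> z) (\<sigma> y) = \<sigma> (quartic_c (h a) (h b) (h c) (h d) z y)"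
    by (simp_all add: quartic_a_def quartic_b_def quartic_c_def hom)
  thus "quartic_a (h a) (h b) (h c) (h d) z y = 0 \<Longrightarrow> quartic_a (h' a) (h' b) (h' c) (h' d) (\<sigma> z) (\<sigma> y) = 0"
    "quartic_b (h a) (h b) (h c) z y = 0 \<Longrightarrow> quartic_b (h' a) (h' b) (h' c) (\<sigma> z) (\<sigma> y) = 0"
    "quartic_c (h a) (h b) (h c) (h d) z y = 0 \<Longrightarrow> quartic_c (h' a) (h' b) (h' c) (h' d) (\<sigma> z) (\<sigma> y) = 0"
    by simp_all
qed

end

context char_two_extension
begin

lemma automorphism_fixing_generators:
  assumes gen: "adjoin h {z, y} = UNIV" and \<sigma>: "K_isomorphism h h \<sigma>" and fixed: "\<sigma> z = z" "\<sigma> y = y"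
  shows "\<sigma> = id"
proof -
  interpret char_two_isomorphism h h \<sigma>
    using ext \<sigma> by unfold_locales
  have "subfield_over h {x. \<sigma> x = x}"
    by (intro subfield_overI) (simp_all add: sigma_h sigma.h_add sigma.h_mult sigma.h_inverse)
  hence "x \<in> {x. \<sigma> x = x}" for x
    by (rule adjoin_induct[OF gen]) (use fixed in simp_all)
  thus ?thesis by auto
qed

lemma trivial_group_AutI:
  assumes "\<And>\<sigma>. K_isomorphism h h \<sigma> \<Longrightarrow> \<sigma> = id"
  shows "trivial_group (Aut h)"
proof -
  have "K_isomorphism h h id" by (simp add: K_isomorphism_def field_extension_def)
  hence carrier: "carrier (Aut h) = {\<one>\<^bsub>Aut h\<^esub>}" using assms by (auto simp: Aut_def)
  moreover have "group (Aut h)"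
    by (rule groupI) (simp_all add: carrier, simp_all add: Aut_def)
  ultimately show ?thesis by (simp add: trivial_group_def)
qed

lemma type_a_automorphism_trivial:
  assumes "type_a h a b c d" and \<sigma>: "K_isomorphism h h \<sigma>"
  shows "\<sigma> = id"
proof -
  interpret char_two_isomorphism h h \<sigma> using ext \<sigma> by unfold_locales
  obtain z y where *: "adjoin h {z, y} = UNIV" "transcendental_over h z"
    "quartic_a (h a) (h b) (h c) (h d) z y = 0"
    and nz: "b \<noteq> 0" "c \<noteq> 0" "a \<notin> squares"
    using assms(1) unfolding type_a_def by blast
  have "z = \<sigma> z \<and> y = \<sigma> y"
    using type_a_generators_rigid[OF * nz generators_transport[OF *(1)] transcendental_transport[OF *(2)]
        quartic_transport(1)[OF *(3)] nz] by blast
  thus ?thesis using automorphism_fixing_generators[OF *(1) \<sigma>] by simp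
qed

lemma type_b_automorphism_trivial:
  assumes "type_b h a b c" and \<sigma>: "K_isomorphism h h \<sigma>"
  shows "\<sigma> = id"
proof -
  interpret char_two_isomorphism h h \<sigma> using ext \<sigma> by unfold_locales
  obtain z y where *: "adjoin h {z, y} = UNIV" "transcendental_over h z"
    "quartic_b (h a) (h b) (h c) z y = 0" and nsq: "b \<notin> squares"
    using assms(1) unfolding type_b_def by blast
  have "z = \<sigma> z \<and> y = \<sigma> y"
    using type_b_generators_unique[OF * nsq generators_transport[OF *(1)] transcendental_transport[OF *(2)]
        quartic_transport(2)[OF *(3)]] .
  thus ?thesis using automorphism_fixing_generators[OF *(1) \<sigma>] by simp
qed

lemma type_c_automorphism_trivial:
  assumes "type_c h a b c d" and \<sigma>: "K_isomorphism h h \<sigma>"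
  shows "\<sigma> = id"
proof -
  interpret char_two_isomorphism h h \<sigma> using ext \<sigma> by unfold_locales
  obtain z y where *: "adjoin h {z, y} = UNIV" "transcendental_over h z"
    "quartic_c (h a) (h b) (h c) (h d) z y = 0"
    and nz: "a \<notin> squares" "b \<notin> squares" "d \<noteq> 0"
    using assms(1) unfolding type_c_def by blast
  have "z = \<sigma> z \<and> y = \<sigma> y"
    using type_c_generators_rigid[OF * nz generators_transport[OF *(1)] transcendental_transport[OF *(2)]
        quartic_transport(3)[OF *(3)] nz] by blast
  thus ?thesis using automorphism_fixing_generators[OF *(1) \<sigma>] by simp
qed

end

context char_two_isomorphism
begin

lemma iota_a_invariant:
  assumes "type_a h a b c d" "type_a h' a' b' c' d'"
  shows "iota_a b c = iota_a b' c'"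
proof -
  obtain z y where *: "adjoin h {z, y} = UNIV" "transcendental_over h z"
    "quartic_a (h a) (h b) (h c) (h d) z y = 0"
    and nz: "b \<noteq> 0" "c \<noteq> 0" "a \<notin> squares"
    using assms(1) unfolding type_a_def by blast
  obtain z' y' where eqs': "adjoin h' {z', y'} = UNIV" "transcendental_over h' z'"
    "quartic_a (h' a') (h' b') (h' c') (h' d') z' y' = 0"
    and nz': "b' \<noteq> 0" "c' \<noteq> 0" "a' \<notin> squares"
    using assms(2) unfolding type_a_def by blast
  show ?thesis
    using target.type_a_generators_rigid[OF generators_transport[OF *(1)] transcendental_transport[OF *(2)]
        quartic_transport(1)[OF *(3)] nz eqs' nz'] by (simp add: iota_a_def)
qed

lemma iota_c_invariant:
  assumes "type_c h a b c d" "type_c h' a' b' c' d'"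
  shows "iota_c a b d = iota_c a' b' d'"
proof -
  obtain z y where *: "adjoin h {z, y} = UNIV" "transcendental_over h z"
    "quartic_c (h a) (h b) (h c) (h d) z y = 0"
    and nz: "a \<notin> squares" "b \<notin> squares" "d \<noteq> 0"
    using assms(1) unfolding type_c_def by blast
  obtain z' y' where eqs': "adjoin h' {z', y'} = UNIV" "transcendental_over h' z'"
    "quartic_c (h' a') (h' b') (h' c') (h' d') z' y' = 0"
    and nz': "a' \<notin> squares" "b' \<notin> squares" "d' \<noteq> 0"
    using assms(2) unfolding type_c_def by blast
  show ?thesis
    using target.type_c_generators_rigid[OF generators_transport[OF *(1)] transcendental_transport[OF *(2)]
        quartic_transport(3)[OF *(3)] nz eqs' nz'] by (simp add: iota_c_def)
qed

end

theorem corollary3p11: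
  fixes h :: "'k::field \<Rightarrow> 'f::field" and h' :: "'k \<Rightarrow> 'g::field"
  assumes "CHAR('k) = 2"
    and "field_extension h" and "field_extension h'"
  shows "((\<exists>a b c d. type_a h a b c d) \<or> (\<exists>a b c. type_b h a b c) \<or> (\<exists>a b c d. type_c h a b c d)
            \<longrightarrow> trivial_group (Aut h))
    \<and> (\<forall>a b c d a' b' c' d'.
          type_a h a b c d \<and> type_a h' a' b' c' d' \<and> K_isomorphic h h'
            \<longrightarrow> iota_a b c = iota_a b' c')
    \<and> (\<forall>a b c d a' b' c' d'.
          type_c h a b c d \<and> type_c h' a' b' c' d' \<and> K_isomorphic h h'
            \<longrightarrow> iota_c a b d = iota_c a' b' d')"
proof -
  interpret char_two_extension h
    using assms by unfold_locales
  have iso: "char_two_isomorphism h h' \<sigma>" if "K_isomorphism h h' \<sigma>" for \<sigma>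
    using assms(3) that by unfold_locales
  have "(\<exists>a b c d. type_a h a b c d) \<or> (\<exists>a b c. type_b h a b c) \<or> (\<exists>a b c d. type_c h a b c d)
            \<longrightarrow> trivial_group (Aut h)"
    using trivial_group_AutI type_a_automorphism_trivial type_b_automorphism_trivial type_c_automorphism_trivial by metis
  moreover have "\<forall>a b c d a' b' c' d'.
          type_a h a b c d \<and> type_a h' a' b' c' d' \<and> K_isomorphic h h'
            \<longrightarrow> iota_a b c = iota_a b' c'"
    unfolding K_isomorphic_def using char_two_isomorphism.iota_a_invariant[OF iso] by blast
  moreover have "\<forall>a b c d a' b' c' d'.
          type_c h a b c d \<and> type_c h' a' b' c' d' \<and> K_isomorphic h h'
            \<longrightarrow> iota_c a b d = iota_c a' b' d'"
    unfolding K_isomorphic_def using char_two_isomorphism.iota_c_invariant[OF iso] by blast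
  ultimately show ?thesis by blast
qed

end
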